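(* For all integers $n>m\geq 3$, $$R(\mathcal{P}^3_m,\mathcal{C}^3_n)=2n+\Big\lfloor\frac{m-1}{2}\Big\rfloor .$$
   Context: The 3-uniform loose path $\mathcal{P}^3_m$ (of length $m$) is the hypergraph with vertex set $\{v_1,\dots,v_{2m+1}\}$ and the $m$ edges $\{v_{2i+1},v_{2i+2},v_{2i+3}\}$, $i=0,1,\dots,m-1$. The 3-uniform loose cycle $\mathcal{C}^3_n$ (of length $n$) is the hypergraph with vertex set $\{v_1,\dots,v_{2n}\}$ and the $n$ edges $\{v_{2i+1},v_{2i+2},v_{2i+3}\}$, $i=0,1,\dots,n-1$, subscripts taken modulo $2n$. For 3-uniform hypergraphs $\mathcal{H},\mathcal{G}$, the Ramsey number $R(\mathcal{H},\mathcal{G})$ is the smallest $N$ such that every red-blue coloring of the edges of the complete 3-uniform hypergraph $\mathcal{K}^3_N$ on $N$ vertices contains a red copy of $\mathcal{H}$ or a blue copy of $\mathcal{G}$ (copies are not necessarily induced). *)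

theory Defs
  imports Main
begin

type_synonym 'a hypergraph = "'a set \<times> 'a set set"

abbreviation vertices :: "'a hypergraph \<Rightarrow> 'a set" where
  "vertices \<equiv> fst"

abbreviation edges :: "'a hypergraph \<Rightarrow> 'a set set" where
  "edges \<equiv> snd"

definition complete3 :: "nat \<Rightarrow> nat hypergraph" where
  "complete3 N = ({1..N}, {e. e \<subseteq> {1..N} \<and> card e = 3})"

text \<open>The vertex \<open>v\<^sub>j\<close> is represented by the number \<open>j\<close>.\<close>

definition loose_path :: "nat \<Rightarrow> nat hypergraph" where
  "loose_path m = ({1..2 * m + 1}, (\<lambda>i. {2 * i + 1, 2 * i + 2, 2 * i + 3}) ` {0..<m})"

text \<open>Subscripts modulo \<open>2n\<close>, with representatives \<open>1, \<dots>, 2n\<close>: the subscript \<open>k + 1\<close> becomes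
  \<open>k mod (2n) + 1\<close>. The hypergraph is 3-uniform for \<open>n \<ge> 2\<close> and a loose cycle in the usual
  sense for \<open>n \<ge> 3\<close>.\<close>

definition loose_cycle :: "nat \<Rightarrow> nat hypergraph" where
  "loose_cycle n = ({1..2 * n},
     (\<lambda>i. {(2 * i) mod (2 * n) + 1, (2 * i + 1) mod (2 * n) + 1, (2 * i + 2) mod (2 * n) + 1})
       ` {0..<n})"

text \<open>A copy of \<open>H\<close> in \<open>G\<close> need not be induced.\<close>

definition contains_copy :: "'b hypergraph \<Rightarrow> 'a hypergraph \<Rightarrow> bool" where
  "contains_copy G H \<longleftrightarrow>
     (\<exists>f. inj_on f (vertices H) \<and> f ` vertices H \<subseteq> vertices G \<and>
          (\<forall>e \<in> edges H. f ` e \<in> edges G))"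

datatype colour = Red | Blue

text \<open>A colouring is a total function on sets of vertices; only its values on edges of \<open>G\<close> matter.\<close>

definition colour_class :: "'a hypergraph \<Rightarrow> ('a set \<Rightarrow> colour) \<Rightarrow> colour \<Rightarrow> 'a hypergraph" where
  "colour_class G c k = (vertices G, {e \<in> edges G. c e = k})"

definition arrows :: "nat \<Rightarrow> 'a hypergraph \<Rightarrow> 'b hypergraph \<Rightarrow> bool" where
  "arrows N H G \<longleftrightarrow>
     (\<forall>c. contains_copy (colour_class (complete3 N) c Red) H \<or>
          contains_copy (colour_class (complete3 N) c Blue) G)"

definition ramsey_number :: "'a hypergraph \<Rightarrow> 'b hypergraph \<Rightarrow> nat" where
  "ramsey_number H G = (LEAST N. arrows N H G)"

end

theory Submission
  imports Defs
begin

text \<open>The colouring in which the triples inside a fixed set of \<open>2n - 1\<close> vertices are blue and all others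
  are red gives the lower bound, because a vertex lies on at most two edges of a loose path.

  For the upper bound let one colour contain a path or cycle with vertices
  \<open>a\<^sub>0, b\<^sub>0, a\<^sub>1, b\<^sub>1, \<dots>\<close> and edges \<open>{a\<^sub>i, b\<^sub>i, a\<^sub>i\<^sub>+\<^sub>1}\<close> that cannot be made longer by one or two
  edges, and let \<open>W\<close> be a set of unused vertices. Call a pair \<open>{p, q}\<close> clean if \<open>{p, q, w}\<close> has the other
  colour for all \<open>w \<in> W\<close>. Of the two pairs \<open>{a\<^sub>i, b\<^sub>i}\<close> and \<open>{b\<^sub>i, a\<^sub>i\<^sub>+\<^sub>1}\<close> one is clean, or both are clean up
  to one vertex. Two clean pairs of the same kind can be joined, since otherwise reversing the segment
  between them yields a longer path. In this way any two edges provide three vertices \<open>p, q, s\<close> such that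
  \<open>{x, p, q}\<close> and \<open>{q, s, y}\<close> have the other colour for almost all \<open>x, y \<in> W\<close>, and these
  configurations are chained through vertices of \<open>W\<close>. Applied to a blue cycle \<open>C\<^sub>n\<^sub>-\<^sub>1\<close> when there is no
  blue \<open>C\<^sub>n\<close>, this gives a red \<open>P\<^sub>m\<close>. Applied to a longest red path it gives the blue cycle that starts the
  induction on \<open>n\<close>. If there is a blue \<open>C\<^sub>n\<^sub>+\<^sub>1\<close> but no blue \<open>C\<^sub>n\<close>, then the red triples that would shorten
  the cycle already contain a red path.\<close>

section \<open>Loose paths as lists\<close>

text \<open>Let \<open>k\<close> be half of \<open>m\<close>, rounded up, so that
  \<open>(m - 1) div 2 = k - 1\<close>. A blue cycle of length \<open>n - 1\<close> leaves
  \<open>k + 1\<close> vertices for \<open>W\<close>. A configuration costs at most two old edges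
  and is worth two new ones, so \<open>2 * k\<close> cycle edges have to produce a red path with
  \<open>2 * k\<close> edges. The obstacle is the lack of slack: a place between two configurations
  may exclude two vertices of \<open>W\<close>, and with \<open>k\<close> configurations all
  \<open>k + 1\<close> vertices of \<open>W\<close> are needed, so that a greedy choice can get
  stuck. A clean pair at the end of the path excludes nothing and saves a vertex of
  \<open>W\<close>. Without clean pairs, the outer configurations are chosen and turned so that the
  two outer places exclude different vertices. If this is impossible, every exclusion concerns one
  vertex \<open>w\<close>; without \<open>w\<close> there are no exclusions, and \<open>k\<close>
  vertices suffice. A second obstacle is a cycle with exactly \<open>2 * k\<close> edges: all of
  them are needed, but the first and the last position carry the same vertex.\<close>

fun lpath :: "('a set \<Rightarrow> bool) \<Rightarrow> 'a list \<Rightarrow> bool" where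
  "lpath E (a # b # c # xs) \<longleftrightarrow> E {a, b, c} \<and> lpath E (c # xs)"
| "lpath E [a] \<longleftrightarrow> True"
| "lpath E [] \<longleftrightarrow> False"
| "lpath E [a, b] \<longleftrightarrow> False"

lemma lpath_odd: "lpath E xs \<Longrightarrow> odd (length xs)"
  by (induction E xs rule: lpath.induct) auto

lemma lpath_append:
  "even (length xs) \<Longrightarrow> lpath E (xs @ x # ys) \<longleftrightarrow> lpath E (xs @ [x]) \<and> lpath E (x # ys)"
proof (induction xs rule: induct_list012)
  case (3 a b zs)
  show ?case
  proof (cases zs)
    case Nil
    then show ?thesis by simp
  next
    case (Cons c ws)
    then show ?thesis using 3 by simp
  qed
qed auto

lemma lpath_appendD:
  assumes "lpath E (xs @ x # ys)" "even (length xs)"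
  shows "lpath E (xs @ [x])" "lpath E (x # ys)"
  using lpath_append[OF assms(2), THEN iffD1, OF assms(1)] by simp_all

lemma lpath_rev: "lpath E (rev xs) \<longleftrightarrow> lpath E xs"
proof (induction E xs rule: lpath.induct)
  case (1 E a b c xs)
  show ?case
  proof (cases "odd (length (c # xs))")
    case True
    then have "lpath E (rev xs @ c # [b, a]) \<longleftrightarrow> lpath E (rev xs @ [c]) \<and> lpath E [c, b, a]"
      by (intro lpath_append) simp
    with 1 show ?thesis by (auto simp: insert_commute)
  next
    case False
    then show ?thesis
      using lpath_odd[of E "rev (a # b # c # xs)"] lpath_odd[of E "a # b # c # xs"] by auto
  qed
qed auto

lemma lpath_nth:
  "lpath E xs \<longleftrightarrow> odd (length xs) \<and>
     (\<forall>i. 2 * i + 2 < length xs \<longrightarrow> E {xs ! (2 * i), xs ! (2 * i + 1), xs ! (2 * i + 2)})"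
proof (induction E xs rule: lpath.induct)
  case (1 E a b c xs)
  have "(\<forall>i. P i) \<longleftrightarrow> P 0 \<and> (\<forall>i. P (Suc i))" for P :: "nat \<Rightarrow> bool"
    using nat.exhaust by metis
  note this[of "\<lambda>i. 2 * i + 2 < length (a # b # c # xs) \<longrightarrow> E {(a # b # c # xs) ! (2 * i),
      (a # b # c # xs) ! (2 * i + 1), (a # b # c # xs) ! (2 * i + 2)}"]
  with 1 show ?case by simp blast
qed auto

text \<open>\<open>E\<close> is the colour of the given path or cycle, so these are the vertices of
  \<open>W\<close> that fail to complete \<open>p, q\<close> to a triple of the other colour. Clean
  pairs are those with an empty set here.\<close>

definition bad :: "('a set \<Rightarrow> bool) \<Rightarrow> 'a set \<Rightarrow> 'a \<Rightarrow> 'a \<Rightarrow> 'a set" where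
  "bad E W p q = {w \<in> W. E {p, q, w}}"

lemma bad_commute: "bad E W p q = bad E W q p"
  by (simp add: bad_def insert_commute)

lemma bad_subset: "bad E W p q \<subseteq> W"
  by (auto simp: bad_def)

section \<open>Unextendable paths and cycles\<close>

text \<open>A loose path (or, when its two ends coincide, a loose cycle) none of whose segments can be
  replaced by a segment with the same ends that is longer by one or two edges and uses additional
  vertices from \<open>W\<close> only.\<close>

locale unextendable =
  fixes E :: "'a set \<Rightarrow> bool" and L :: "'a list" and W :: "'a set"
  assumes lpath_L: "lpath E L"
    and distinct_L: "distinct (tl L)" "distinct (butlast L)"
    and fin_W: "finite W"
    and W_L: "W \<inter> set L = {}"
    and no_ext: "\<lbrakk>L = as @ a # s @ b # bs; even (length as); lpath E (a # s' @ [b]); distinct s';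
        set s' \<subseteq> set s \<union> W; length s' = length s + 2 \<or> length s' = length s + 4\<rbrakk> \<Longrightarrow> False"
begin

lemma distinct_inner:
  assumes "L = as @ a # s @ b # bs"
  shows "distinct s"
proof -
  have "distinct (tl (as @ a # s @ b # bs))"
    using distinct_L(1) unfolding assms .
  then show ?thesis by (cases as) auto
qed

text \<open>Otherwise \<open>a, y, b, y', c\<close> replaces the edge \<open>a, b, c\<close> by two
  edges. Consequently the two bad sets of an edge are the same singleton, or one of them is
  empty.\<close>

lemma split_edge:
  assumes i: "2 * i + 2 < length L"
    and y: "y \<in> bad E W (L ! (2 * i)) (L ! (2 * i + 1))"
    and y': "y' \<in> bad E W (L ! (2 * i + 1)) (L ! (2 * i + 2))"
  shows "y = y'"
proof (rule ccontr)
  assume "y \<noteq> y'"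
  have L: "L = take (2 * i) L @ L ! (2 * i) # [L ! (2 * i + 1)] @ L ! (2 * i + 2) # drop (2 * i + 3) L"
    using i by (simp add: Cons_nth_drop_Suc numeral_3_eq_3)
  have mem: "L ! (2 * i) \<in> set L" "L ! (2 * i + 1) \<in> set L" "L ! (2 * i + 2) \<in> set L"
    using i by auto
  show False
  proof (rule no_ext[OF L, where s' = "[y, L ! (2 * i + 1), y']"])
    show "lpath E (L ! (2 * i) # [y, L ! (2 * i + 1), y'] @ [L ! (2 * i + 2)])"
      using y y' by (simp add: bad_def insert_commute)
    show "distinct [y, L ! (2 * i + 1), y']"
      using y y' \<open>y \<noteq> y'\<close> W_L mem by (auto simp: bad_def)
  qed (use i y y' in \<open>auto simp: bad_def\<close>)
qed

lemma split_two:
  assumes "i < j" "2 * j + 2 < length L"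
  obtains as mid bs where
    "L = as @ L ! (2 * i) # (L ! (2 * i + 1) # mid @ [L ! (2 * j + 1)]) @ L ! (2 * j + 2) # bs"
    "even (length as)" "odd (length mid)" "hd mid = L ! (2 * i + 2)" "last mid = L ! (2 * j)"
proof
  let ?mid = "map ((!) L) [2 * i + 2..<2 * j + 1]"
  let ?as = "map ((!) L) [0..<2 * i]" and ?bs = "map ((!) L) [2 * j + 3..<length L]"
  have u: "[m..<length L] = [m..<n] @ [n..<length L]" if "m \<le> n" "n \<le> length L" for m n
    using upt_add_eq_append[of m n "length L - n"] that by simp
  have "?as @ L ! (2 * i) # (L ! (2 * i + 1) # ?mid @ [L ! (2 * j + 1)]) @ L ! (2 * j + 2) # ?bs
      = map ((!) L) ([0..<2 * i] @ [2 * i, 2 * i + 1] @ [2 * i + 2..<2 * j + 1] @ [2 * j + 1, 2 * j + 2]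
          @ [2 * j + 3..<length L])"
    by simp
  also have "[0..<2 * i] @ [2 * i, 2 * i + 1] @ [2 * i + 2..<2 * j + 1] @ [2 * j + 1, 2 * j + 2]
      @ [2 * j + 3..<length L] = [0..<length L]"
    using assms u[of 0 "2 * i"] u[of "2 * i + 2" "2 * j + 1"]
    by (simp add: upt_conv_Cons numeral_3_eq_3)
  finally show "L = ?as @ L ! (2 * i) # (L ! (2 * i + 1) # ?mid @ [L ! (2 * j + 1)]) @ L ! (2 * j + 2) # ?bs"
    by (simp only: map_nth)
  show "odd (length ?mid)" using assms by simp
  show "hd ?mid = L ! (2 * i + 2)" using assms by (simp add: upt_conv_Cons del: upt_Suc)
  show "last ?mid = L ! (2 * j)" using assms by (simp add: last_map)
qed simp

text \<open>The segment \<open>a\<^sub>i, b\<^sub>i, a\<^sub>i\<^sub>+\<^sub>1, \<dots>, a\<^sub>j, b\<^sub>j, a\<^sub>j\<^sub>+\<^sub>1\<close> is replaced by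
  \<open>a\<^sub>i, w, a\<^sub>j, \<dots>, a\<^sub>i\<^sub>+\<^sub>1, b\<^sub>i, y, b\<^sub>j, a\<^sub>j\<^sub>+\<^sub>1\<close> or by
  \<open>a\<^sub>i, w, a\<^sub>j, \<dots>, a\<^sub>i\<^sub>+\<^sub>1, y, b\<^sub>i, w', b\<^sub>j, y', a\<^sub>j\<^sub>+\<^sub>1\<close>.\<close>

lemma reverse_segment:
  assumes ij: "i < j" "2 * j + 2 < length L"
    and w: "w \<in> bad E W (L ! (2 * i)) (L ! (2 * j))"
    and y: "y \<in> bad E W (L ! (2 * i + 1)) (L ! (2 * i + 2))"
    and y': "y' \<in> bad E W (L ! (2 * j + 1)) (L ! (2 * j + 2))"
  shows reverse_segment_1: "y = y' \<Longrightarrow> w = y"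
    and reverse_segment_2: "w' \<in> bad E W (L ! (2 * i + 1)) (L ! (2 * j + 1)) \<Longrightarrow> \<not> distinct [w, y, w', y']"
proof -
  obtain as mid bs where L:
    "L = as @ L ! (2 * i) # (L ! (2 * i + 1) # mid @ [L ! (2 * j + 1)]) @ L ! (2 * j + 2) # bs"
    and ev: "even (length as)" and om: "odd (length mid)"
    and hm: "hd mid = L ! (2 * i + 2)" and lm: "last mid = L ! (2 * j)"
    using split_two[OF ij] by blast
  define a b d e where "a = L ! (2 * i)" and "b = L ! (2 * i + 1)"
    and "d = L ! (2 * j + 1)" and "e = L ! (2 * j + 2)"
  define c z where "c = hd mid" and "z = last mid"
  obtain xs where xs: "mid = c # xs" using om unfolding c_def by (cases mid) auto
  obtain ys where ys: "mid = ys @ [z]" using om unfolding z_def by (cases mid rule: rev_cases) auto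
  have exs: "even (length xs)" "even (length ys)"
    using om arg_cong[OF xs, of length] arg_cong[OF ys, of length] by auto
  have L': "L = as @ a # (b # mid @ [d]) @ e # bs"
    using L by (simp add: a_def b_def d_def e_def)
  have dist: "distinct (b # mid @ [d])" using distinct_inner[OF L'] .
  have sub: "insert a (insert b (insert d (insert e (set mid)))) \<subseteq> set L" by (subst L') auto
  have "lpath E (a # (b # mid @ [d]) @ e # bs)"
    using lpath_L[unfolded L'] ev by (rule lpath_appendD)
  then have "lpath E (c # xs @ d # e # bs)" by (simp add: xs)
  then have "lpath E (ys @ z # d # e # bs)" using xs ys by (metis append_Cons append_Nil append_assoc)
  then have "lpath E mid" using lpath_appendD(1)[OF _ exs(2)] ys by simp
  then have rmid: "lpath E (rev mid)" by (simp add: lpath_rev)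
  \<comment> \<open>Both replacements run backwards through \<open>mid\<close> from \<open>z\<close>
    to \<open>c\<close>; they differ only in the part \<open>s\<close> after \<open>c\<close>, which
    is all that remains to be checked.\<close>
  have new: "lpath E (a # (w # rev mid @ s) @ [e]) \<longleftrightarrow> lpath E (c # s @ [e])" for s
  proof -
    have "lpath E ((a # w # rev xs) @ c # s @ [e]) \<longleftrightarrow>
        lpath E ((a # w # rev xs) @ [c]) \<and> lpath E (c # s @ [e])"
      by (rule lpath_append) (use exs in simp)
    moreover have "lpath E (a # w # rev xs @ [c])"
    proof -
      have "a # w # rev xs @ [c] = a # w # z # rev ys" using xs ys by (metis rev.simps(2) rev_eq_Cons_iff rev_rev_ident)
      moreover have "E {a, w, z}" using w lm by (simp add: bad_def a_def z_def insert_commute)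
      ultimately show ?thesis using rmid ys by simp
    qed
    ultimately show ?thesis by (simp add: xs)
  qed
  show "w = y" if "y = y'"
  proof (rule ccontr)
    assume "w \<noteq> y"
    show False
    proof (rule no_ext[OF L' ev, where s' = "w # rev mid @ [b, y, d]"])
      show "lpath E (a # (w # rev mid @ [b, y, d]) @ [e])"
        using y y' that hm unfolding new by (simp add: bad_def b_def c_def d_def e_def insert_commute)
    qed (use dist sub w y W_L \<open>w \<noteq> y\<close> in \<open>auto simp: bad_def\<close>)
  qed
  show "\<not> distinct [w, y, w', y']" if w': "w' \<in> bad E W (L ! (2 * i + 1)) (L ! (2 * j + 1))"
  proof
    assume d4: "distinct [w, y, w', y']"
    show False
    proof (rule no_ext[OF L' ev, where s' = "w # rev mid @ [y, b, w', d, y']"])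
      show "lpath E (a # (w # rev mid @ [y, b, w', d, y']) @ [e])"
        using y y' w' hm unfolding new by (simp add: bad_def b_def c_def d_def e_def insert_commute)
    qed (use dist sub w y w' y' W_L d4 in \<open>auto simp: bad_def\<close>)
  qed
qed

end

lemma ex_not_in:
  assumes "finite F" "card F < card A"
  obtains x where "x \<in> A" "x \<notin> F"
  using assms by (metis card_mono linorder_not_le subsetI)

context unextendable
begin

lemma finite_bad [simp]: "finite (bad E W p q)"
  using fin_W bad_subset by (rule rev_finite_subset)

text \<open>If both sets had three elements, four distinct vertices for the longer replacement in
  \<open>reverse_segment\<close> could be chosen. Three are needed because \<open>w'\<close> has to
  avoid two earlier choices.\<close>

lemma left_join:
  assumes ij: "i < j" "2 * j + 2 < length L"
    and Yi: "2 \<le> card (bad E W (L ! (2 * i + 1)) (L ! (2 * i + 2)))"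
    and Yj: "2 \<le> card (bad E W (L ! (2 * j + 1)) (L ! (2 * j + 2)))"
  shows "card (bad E W (L ! (2 * i)) (L ! (2 * j))) \<le> 2 \<or>
    card (bad E W (L ! (2 * i + 1)) (L ! (2 * j + 1))) \<le> 2"
proof (rule ccontr)
  let ?Y = "bad E W (L ! (2 * i + 1)) (L ! (2 * i + 2))"
  let ?Z = "bad E W (L ! (2 * j + 1)) (L ! (2 * j + 2))"
  let ?A = "bad E W (L ! (2 * i)) (L ! (2 * j))"
  let ?B = "bad E W (L ! (2 * i + 1)) (L ! (2 * j + 1))"
  assume "\<not> ?thesis"
  then have A: "2 < card ?A" and B: "2 < card ?B" by auto
  have disj: "?Y \<inter> ?Z = {}"
  proof (rule ccontr)
    assume "?Y \<inter> ?Z \<noteq> {}"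
    then obtain y where "y \<in> ?Y" "y \<in> ?Z" by blast
    moreover obtain w where "w \<in> ?A" "w \<notin> {y}" using ex_not_in[of "{y}" ?A] A by auto
    ultimately show False using reverse_segment_1[OF ij] by blast
  qed
  obtain w where w: "w \<in> ?A" using A by fastforce
  \<comment> \<open>Since \<open>?Y\<close> and \<open>?Z\<close> are disjoint, \<open>w\<close> can
    obstruct only one of them. That one is served first, then \<open>w'\<close>, and the other set
    has to avoid \<open>w'\<close> only.\<close>
  have "\<exists>w' y z. w' \<in> ?B \<and> y \<in> ?Y \<and> z \<in> ?Z \<and> distinct [w, y, w', z]"
  proof (cases "w \<in> ?Y")
    case True
    obtain y where y: "y \<in> ?Y" "y \<notin> {w}" using ex_not_in[of "{w}" ?Y] Yi by auto
    obtain w' where w': "w' \<in> ?B" "w' \<notin> {w, y}"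
      using ex_not_in[of "{w, y}" ?B] B y by (auto simp: card_insert_if split: if_splits)
    obtain z where z: "z \<in> ?Z" "z \<notin> {w'}" using ex_not_in[of "{w'}" ?Z] Yj by auto
    show ?thesis using y w' z True disj
      by (intro exI[of _ w'] exI[of _ y] exI[of _ z]) auto
  next
    case False
    obtain z where z: "z \<in> ?Z" "z \<notin> {w}" using ex_not_in[of "{w}" ?Z] Yj by auto
    obtain w' where w': "w' \<in> ?B" "w' \<notin> {w, z}"
      using ex_not_in[of "{w, z}" ?B] B z by (auto simp: card_insert_if split: if_splits)
    obtain y where y: "y \<in> ?Y" "y \<notin> {w'}" using ex_not_in[of "{w'}" ?Y] Yi by auto
    show ?thesis using y w' z False disj
      by (intro exI[of _ w'] exI[of _ y] exI[of _ z]) auto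
  qed
  then show False using reverse_segment_2[OF ij w] by blast
qed

text \<open>Supplies the mirror image of \<open>left_join\<close>. The parity of the prefix survives
  because the whole list has odd length.\<close>

lemma unextendable_rev: "unextendable E (rev L) W"
proof
  show "lpath E (rev L)" using lpath_L by (simp add: lpath_rev)
  show "distinct (tl (rev L))" "distinct (butlast (rev L))"
    using distinct_L by (metis butlast_rev distinct_rev rev_rev_ident)+
  show "finite W" by (rule fin_W)
  show "W \<inter> set (rev L) = {}" using W_L by simp
next
  fix as a s b bs s'
  assume L: "rev L = as @ a # s @ b # bs" and "even (length as)"
    and p: "lpath E (a # s' @ [b])" and "distinct s'" "set s' \<subseteq> set s \<union> W"
    and len: "length s' = length s + 2 \<or> length s' = length s + 4"
  have "L = rev (as @ a # s @ b # bs)" using L by (metis rev_rev_ident)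
  then have L': "L = rev bs @ b # rev s @ a # rev as" by simp
  show False
  proof (rule no_ext[OF L', of "rev s'"])
    have "odd (length (rev L))" "odd (length (a # s' @ [b]))"
      using lpath_odd[OF lpath_L] lpath_odd[OF p] by simp_all
    then show "even (length (rev bs))"
      unfolding L using \<open>even (length as)\<close> len by auto
    show "lpath E (b # rev s' @ [a])"
      using p lpath_rev[of E "a # s' @ [b]"] by simp
  qed (use \<open>distinct s'\<close> \<open>set s' \<subseteq> set s \<union> W\<close> len in auto)
qed

end

text \<open>The edges of the sequence are the triples \<open>{v(2i), v(2i+1), v(2i+2)}\<close> for \<open>i < r\<close>. That they belong
  to \<open>E\<close> is not assumed: only the listed consequences of unextendability are used.\<close>

locale segment =
  fixes E :: "'a set \<Rightarrow> bool" and v :: "nat \<Rightarrow> 'a" and W :: "'a set" and r :: nat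
  assumes finite_W: "finite W"
    and swap: "\<lbrakk>i < r; y \<in> bad E W (v (2 * i)) (v (2 * i + 1));
        y' \<in> bad E W (v (2 * i + 1)) (v (2 * i + 2))\<rbrakk> \<Longrightarrow> y = y'"
    and join_left: "\<lbrakk>i < j; j < r; 2 \<le> card (bad E W (v (2 * i + 1)) (v (2 * i + 2)));
        2 \<le> card (bad E W (v (2 * j + 1)) (v (2 * j + 2)))\<rbrakk> \<Longrightarrow>
        card (bad E W (v (2 * i)) (v (2 * j))) \<le> 2 \<or>
        card (bad E W (v (2 * i + 1)) (v (2 * j + 1))) \<le> 2"
    and join_right: "\<lbrakk>i < j; j < r; 2 \<le> card (bad E W (v (2 * i)) (v (2 * i + 1)));
        2 \<le> card (bad E W (v (2 * j)) (v (2 * j + 1)))\<rbrakk> \<Longrightarrow>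
        card (bad E W (v (2 * i + 1)) (v (2 * j + 1))) \<le> 2 \<or>
        card (bad E W (v (2 * i + 2)) (v (2 * j + 2))) \<le> 2"

text \<open>A window of \<open>r\<close> consecutive edges beginning with edge \<open>n\<close>.
  \<open>join_right\<close> is \<open>left_join\<close> for the reversed list, in which edge
  \<open>i\<close> of a list with \<open>q\<close> edges becomes edge \<open>q - 1 - i\<close> and
  the order of two edges is exchanged.\<close>

lemma (in unextendable) segment:
  assumes "2 * (n + r) < length L"
  shows "segment E (\<lambda>x. L ! (2 * n + x)) W r"
proof
  show "finite W" by (rule fin_W)
next
  fix i y y'
  assume "i < r" "y \<in> bad E W (L ! (2 * n + 2 * i)) (L ! (2 * n + (2 * i + 1)))"
    "y' \<in> bad E W (L ! (2 * n + (2 * i + 1))) (L ! (2 * n + (2 * i + 2)))"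
  then show "y = y'"
    using split_edge[of "n + i" y y'] assms by (auto simp: add.assoc distrib_left)
next
  fix i j
  assume "i < j" "j < r"
    "2 \<le> card (bad E W (L ! (2 * n + (2 * i + 1))) (L ! (2 * n + (2 * i + 2))))"
    "2 \<le> card (bad E W (L ! (2 * n + (2 * j + 1))) (L ! (2 * n + (2 * j + 2))))"
  then show "card (bad E W (L ! (2 * n + 2 * i)) (L ! (2 * n + 2 * j))) \<le> 2 \<or>
      card (bad E W (L ! (2 * n + (2 * i + 1))) (L ! (2 * n + (2 * j + 1)))) \<le> 2"
    using left_join[of "n + i" "n + j"] assms by (auto simp: add.assoc distrib_left)
next
  interpret R: unextendable E "rev L" W by (rule unextendable_rev)
  fix i j
  assume ij: "i < j" "j < r"
    and c: "2 \<le> card (bad E W (L ! (2 * n + 2 * i)) (L ! (2 * n + (2 * i + 1))))"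
    "2 \<le> card (bad E W (L ! (2 * n + 2 * j)) (L ! (2 * n + (2 * j + 1))))"
  obtain q where q: "length L = 2 * q + 1" using lpath_odd[OF lpath_L] by (elim oddE)
  have nth: "rev L ! k = L ! (2 * q - k)" if "k \<le> 2 * q" for k
    using that q by (simp add: rev_nth)
  let ?i = "q - 1 - (n + i)" and ?j = "q - 1 - (n + j)"
  have eq: "rev L ! (2 * ?i) = L ! (2 * n + (2 * i + 2))" "rev L ! (2 * ?i + 1) = L ! (2 * n + (2 * i + 1))"
    "rev L ! (2 * ?i + 2) = L ! (2 * n + 2 * i)"
    "rev L ! (2 * ?j) = L ! (2 * n + (2 * j + 2))" "rev L ! (2 * ?j + 1) = L ! (2 * n + (2 * j + 1))"
    "rev L ! (2 * ?j + 2) = L ! (2 * n + 2 * j)"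
    using assms q ij by (auto simp: nth intro!: arg_cong[of _ _ "(!) L"])
  show "card (bad E W (L ! (2 * n + (2 * i + 1))) (L ! (2 * n + (2 * j + 1)))) \<le> 2 \<or>
      card (bad E W (L ! (2 * n + (2 * i + 2))) (L ! (2 * n + (2 * j + 2)))) \<le> 2"
    using R.left_join[of ?j ?i, unfolded eq] ij assms q c by (auto simp: bad_commute)
qed

section \<open>Configurations\<close>

text \<open>Scan from the left: if \<open>d i\<close> holds and \<open>i + 1\<close> exists, pair
  them and continue at \<open>i + 2\<close>; otherwise leave \<open>i\<close> single.
  \<open>M\<close> holds the left members of the pairs and \<open>S\<close> the singles. Starting at
  \<open>0\<close> forces \<open>0\<close> into \<open>M\<close> whenever \<open>d 0\<close> holds,
  which is what the seam of a closed cycle requires.\<close>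

lemma greedy_matching:
  fixes d :: "nat \<Rightarrow> bool"
  shows "\<exists>M S. M \<subseteq> {i. Suc i < r} \<and> S \<subseteq> {..<r} \<and> M \<inter> S = {} \<and> Suc ` M \<inter> S = {} \<and>
    M \<inter> Suc ` M = {} \<and> 2 * card M + card S = r \<and> (\<forall>i\<in>M. d i) \<and>
    (\<forall>i\<in>S. Suc i \<in> S \<longrightarrow> \<not> d i) \<and> (1 < r \<and> d 0 \<longrightarrow> 0 \<in> M)"
  proof (induction r arbitrary: d rule: less_induct)
    case (less r)
    have fin: "finite M" "finite S" if "M \<subseteq> {i. Suc i < r'}" "S \<subseteq> {..<r'}" for M S r'
      using that by (auto intro!: finite_subset[of M "{..<r'}"] finite_subset[of S "{..<r'}"])
    consider "r = 0" | "1 < r \<and> d 0" | "0 < r" "\<not> (1 < r \<and> d 0)" by linarith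
    then show ?case
    proof cases
      case 1
      then show ?thesis by (intro exI[of _ "{}"]) auto
    next
      case 2
      define q where "q = r - 2"
      from 2 have "1 < r" by blast
      then have r: "r = Suc (Suc q)" unfolding q_def by linarith
      have "q < r" using r by simp
      from less[OF this, of "\<lambda>i. d (Suc (Suc i))"] obtain M S where
        MS: "M \<subseteq> {i. Suc i < q}" "S \<subseteq> {..<q}" "M \<inter> S = {}" "Suc ` M \<inter> S = {}"
        "M \<inter> Suc ` M = {}" "2 * card M + card S = q" "\<forall>i\<in>M. d (Suc (Suc i))"
        "\<forall>i\<in>S. Suc i \<in> S \<longrightarrow> \<not> d (Suc (Suc i))" by (elim exE conjE)
      define M' S' where "M' = insert 0 ((Suc \<circ> Suc) ` M)" and "S' = (Suc \<circ> Suc) ` S"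
      have c: "card M' = Suc (card M)" "card S' = card S"
        using fin[OF MS(1,2)] by (simp_all add: M'_def S'_def card_insert_if card_image inj_on_def image_iff)
      have "M' \<subseteq> {i. Suc i < r}" "S' \<subseteq> {..<r}"
        using MS(1,2) by (auto simp: M'_def S'_def r)
      moreover have "M' \<inter> S' = {}" "Suc ` M' \<inter> S' = {}" "M' \<inter> Suc ` M' = {}"
        using MS(3-5) by (auto simp: M'_def S'_def)
      moreover have "2 * card M' + card S' = r" using c MS(6) r by simp
      moreover have "\<forall>i\<in>M'. d i" "\<forall>i\<in>S'. Suc i \<in> S' \<longrightarrow> \<not> d i" "0 \<in> M'"
        using MS(7,8) 2 by (auto simp: M'_def S'_def)
      ultimately show ?thesis by blast
    next
      case 3
      then obtain q where r: "r = Suc q" by (cases r) auto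
      then have "q < r" by simp
      from less[OF this, of "\<lambda>i. d (Suc i)"] obtain M S where
        MS: "M \<subseteq> {i. Suc i < q}" "S \<subseteq> {..<q}" "M \<inter> S = {}" "Suc ` M \<inter> S = {}"
        "M \<inter> Suc ` M = {}" "2 * card M + card S = q" "\<forall>i\<in>M. d (Suc i)"
        "\<forall>i\<in>S. Suc i \<in> S \<longrightarrow> \<not> d (Suc i)" by (elim exE conjE)
      define M' S' where "M' = Suc ` M" and "S' = insert 0 (Suc ` S)"
      have c: "card M' = card M" "card S' = Suc (card S)"
        using fin[OF MS(1,2)] by (simp_all add: M'_def S'_def card_insert_if card_image image_iff)
      have "M' \<subseteq> {i. Suc i < r}" "S' \<subseteq> {..<r}"
        using MS(1,2) by (auto simp: M'_def S'_def r)
      moreover have "M' \<inter> S' = {}" "Suc ` M' \<inter> S' = {}" "M' \<inter> Suc ` M' = {}"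
        using MS(3-5) by (auto simp: M'_def S'_def)
      moreover have "2 * card M' + card S' = r" using c MS(6) r by simp
      moreover have "\<forall>i\<in>M'. d i"
        using MS(7) by (auto simp: M'_def)
      moreover have "\<forall>i\<in>S'. Suc i \<in> S' \<longrightarrow> \<not> d i"
      proof (intro ballI impI)
        fix i assume i: "i \<in> S'" "Suc i \<in> S'"
        then have "1 < r" using \<open>S' \<subseteq> {..<r}\<close> by auto
        then show "\<not> d i" using i 3 MS(8) by (auto simp: S'_def)
      qed
      ultimately show ?thesis using 3 by blast
    qed
  qed

definition side1 :: "('a set \<Rightarrow> bool) \<Rightarrow> 'a set \<Rightarrow> 'a list \<Rightarrow> 'a set" where
  "side1 E W C = bad E W (C ! 0) (C ! 1)"

definition side2 :: "('a set \<Rightarrow> bool) \<Rightarrow> 'a set \<Rightarrow> 'a list \<Rightarrow> 'a set" where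
  "side2 E W C = bad E W (C ! 1) (C ! 2)"

definition small :: "('a set \<Rightarrow> bool) \<Rightarrow> 'a set \<Rightarrow> 'a list \<Rightarrow> bool" where
  "small E W C \<longleftrightarrow> length C = 3 \<and> card (side1 E W C) \<le> 1 \<and> card (side2 E W C) \<le> 1"

text \<open>Made from two clean pairs of the same kind. The empty first side makes up for a second
  side of size two: after a small configuration or another joint, the place in front of a joint
  still excludes at most two vertices.\<close>

definition joint :: "('a set \<Rightarrow> bool) \<Rightarrow> 'a set \<Rightarrow> 'a list \<Rightarrow> bool" where
  "joint E W C \<longleftrightarrow> length C = 3 \<and> side1 E W C = {} \<and> card (side2 E W C) \<le> 2"

context segment
begin

text \<open>If one of the two pairs of an edge is bad for at least two vertices, then the assumption \<open>swap\<close> makes the other pair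
  clean. This is what the next two definitions record, hence they mention the opposite pair.\<close>

definition left_clean :: "nat \<Rightarrow> bool" where
  "left_clean i \<longleftrightarrow> 2 \<le> card (bad E W (v (2 * i + 1)) (v (2 * i + 2)))"

definition right_clean :: "nat \<Rightarrow> bool" where
  "right_clean i \<longleftrightarrow> 2 \<le> card (bad E W (v (2 * i)) (v (2 * i + 1)))"

text \<open>The pair is clean only under \<open>left_clean i\<close> or
  \<open>right_clean i\<close>. It consists of positions rather than vertices, so disjointness is
  settled before the injectivity of \<open>v\<close> enters.\<close>

definition clean_pair :: "nat \<Rightarrow> nat list" where
  "clean_pair i = (if left_clean i then [2 * i, 2 * i + 1] else [2 * i + 1, 2 * i + 2])"

lemma finite_bad [simp]: "finite (bad E W p q)"
  using finite_W bad_subset by (rule rev_finite_subset)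

lemma bad_clean_pair:
  assumes "i < r" "left_clean i \<or> right_clean i"
  shows "bad E W (v (clean_pair i ! 0)) (v (clean_pair i ! 1)) = {}"
proof (rule ccontr)
  assume "bad E W (v (clean_pair i ! 0)) (v (clean_pair i ! 1)) \<noteq> {}"
  then obtain z where z: "z \<in> bad E W (v (clean_pair i ! 0)) (v (clean_pair i ! 1))" by blast
  show False
  proof (cases "left_clean i")
    case True
    then obtain y where "y \<in> bad E W (v (2 * i + 1)) (v (2 * i + 2))" "y \<notin> {z}"
      using ex_not_in[of "{z}" "bad E W (v (2 * i + 1)) (v (2 * i + 2))"] by (auto simp: left_clean_def)
    then show ?thesis using swap[OF assms(1), of z y] z True by (auto simp: clean_pair_def)
  next
    case False
    then obtain y where "y \<in> bad E W (v (2 * i)) (v (2 * i + 1))" "y \<notin> {z}"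
      using ex_not_in[of "{z}" "bad E W (v (2 * i)) (v (2 * i + 1))"] assms(2) by (auto simp: right_clean_def)
    then show ?thesis using swap[OF assms(1), of y z] z False by (auto simp: clean_pair_def)
  qed
qed

lemma not_left_right_clean: "i < r \<Longrightarrow> left_clean i \<Longrightarrow> \<not> right_clean i"
  using bad_clean_pair[of i] by (auto simp: clean_pair_def right_clean_def)

lemma join_ex:
  assumes ij: "i < r" "j < r" "i \<noteq> j" and same: "left_clean i \<and> left_clean j \<or> right_clean i \<and> right_clean j"
  obtains C where "set C \<subseteq> set (clean_pair i) \<union> set (clean_pair j)" "joint E W (map v C)"
    "distinct (clean_pair i @ clean_pair j) \<longrightarrow> distinct C"
proof -
  have "\<exists>C. set C \<subseteq> set (clean_pair i) \<union> set (clean_pair j) \<and> joint E W (map v C) \<and> (distinct (clean_pair i @ clean_pair j) \<longrightarrow> distinct C)"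
    using ij same
  proof (induction i j rule: linorder_wlog)
    case (le i j)
    then have "i < j" by simp
    have c: "bad E W (v (clean_pair i ! 0)) (v (clean_pair i ! 1)) = {}" using bad_clean_pair le by blast
    show ?case
    proof (cases "left_clean i \<and> left_clean j")
      case True
      then have "card (bad E W (v (2 * i)) (v (2 * j))) \<le> 2 \<or>
          card (bad E W (v (2 * i + 1)) (v (2 * j + 1))) \<le> 2"
        using join_left[OF \<open>i < j\<close>] le by (auto simp: left_clean_def)
      then show ?thesis
      proof
        assume "card (bad E W (v (2 * i)) (v (2 * j))) \<le> 2"
        then show ?thesis using c True
          by (intro exI[of _ "[2 * i + 1, 2 * i, 2 * j]"])
            (auto simp: joint_def side1_def side2_def clean_pair_def bad_commute)
      next
        assume "card (bad E W (v (2 * i + 1)) (v (2 * j + 1))) \<le> 2"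
        then show ?thesis using c True
          by (intro exI[of _ "[2 * i, 2 * i + 1, 2 * j + 1]"])
            (auto simp: joint_def side1_def side2_def clean_pair_def)
      qed
    next
      case False
      then have R: "right_clean i" "right_clean j" "\<not> left_clean i" "\<not> left_clean j" using le not_left_right_clean by auto
      then have "card (bad E W (v (2 * i + 1)) (v (2 * j + 1))) \<le> 2 \<or>
          card (bad E W (v (2 * i + 2)) (v (2 * j + 2))) \<le> 2"
        using join_right[OF \<open>i < j\<close>] le by (auto simp: right_clean_def)
      then show ?thesis
      proof
        assume "card (bad E W (v (2 * i + 1)) (v (2 * j + 1))) \<le> 2"
        then show ?thesis using c R
          by (intro exI[of _ "[2 * i + 2, 2 * i + 1, 2 * j + 1]"])
            (auto simp: joint_def side1_def side2_def clean_pair_def bad_commute)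
      next
        assume "card (bad E W (v (2 * i + 2)) (v (2 * j + 2))) \<le> 2"
        then show ?thesis using c R
          by (intro exI[of _ "[2 * i + 1, 2 * i + 2, 2 * j + 2]"])
            (auto simp: joint_def side1_def side2_def clean_pair_def)
      qed
    qed
  next
    case (sym i j)
    then have "\<exists>C. set C \<subseteq> set (clean_pair j) \<union> set (clean_pair i) \<and> joint E W (map v C) \<and>
        (distinct (clean_pair j @ clean_pair i) \<longrightarrow> distinct C)" by blast
    then show ?case by (simp add: Un_commute Int_commute) blast
  qed
  then show thesis using that by blast
qed

text \<open>Among any three members two are of the same kind, left or right, and can be joined. This
  is repeated while at least four members remain; \<open>e\<close> and \<open>f\<close> are kept
  back to serve as ends.\<close>

lemma joins:
  assumes "finite P" "2 \<le> card P" "\<And>i. i \<in> P \<Longrightarrow> i < r \<and> (left_clean i \<or> right_clean i)"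
    and "\<And>i j. i \<in> P \<Longrightarrow> j \<in> P \<Longrightarrow> i \<noteq> j \<Longrightarrow> set (clean_pair i) \<inter> set (clean_pair j) = {}"
  shows "\<exists>e f Js. e \<in> P \<and> f \<in> P \<and> e \<noteq> f \<and> length Js = (card P - 2) div 2 \<and>
    (\<forall>C\<in>set Js. joint E W (map v C)) \<and> distinct (concat Js) \<and>
    set (concat Js) \<subseteq> (\<Union>i\<in>P - {e, f}. set (clean_pair i))"
  using assms
proof (induction "card P" arbitrary: P rule: less_induct)
  case (less P)
  obtain i where i: "i \<in> P" using less.prems by fastforce
  obtain j where j: "j \<in> P" "j \<notin> {i}" using ex_not_in[of "{i}" P] less.prems by auto
  show ?case
  proof (cases "card P < 4")
    case True
    then have "(card P - 2) div 2 = 0" by auto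
    then show ?thesis using i j by (intro exI[of _ i] exI[of _ j] exI[of _ "[]"]) auto
  next
    case False
    have "card {i, j} = 2" using j by auto
    then obtain k where k: "k \<in> P" "k \<notin> {i, j}" using ex_not_in[of "{i, j}" P] False by auto
    obtain a b where ab: "a \<in> P" "b \<in> P" "a \<noteq> b" "left_clean a \<and> left_clean b \<or> right_clean a \<and> right_clean b"
      using i j k less.prems(3) by blast
    have cab: "card (P - {a, b}) = card P - 2"
      using ab by (simp add: card_Diff_subset)
    obtain C where C: "set C \<subseteq> set (clean_pair a) \<union> set (clean_pair b)" "joint E W (map v C)"
      "distinct (clean_pair a @ clean_pair b) \<longrightarrow> distinct C"
      using join_ex[of a b] less.prems(3) ab by metis
    have dC: "distinct C" using C(3) less.prems(4)[OF ab(1-3)] by (auto simp: clean_pair_def)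
    have "\<exists>e f Js. e \<in> P - {a, b} \<and> f \<in> P - {a, b} \<and> e \<noteq> f \<and> length Js = (card (P - {a, b}) - 2) div 2 \<and>
      (\<forall>C\<in>set Js. joint E W (map v C)) \<and> distinct (concat Js) \<and>
      set (concat Js) \<subseteq> (\<Union>i\<in>(P - {a, b}) - {e, f}. set (clean_pair i))"
      by (rule less.hyps) (use less.prems False cab in auto)
    then obtain e f Js where *: "e \<in> P - {a, b}" "f \<in> P - {a, b}" "e \<noteq> f"
      "length Js = (card (P - {a, b}) - 2) div 2"
      "\<forall>C\<in>set Js. joint E W (map v C)" "distinct (concat Js)"
      "set (concat Js) \<subseteq> (\<Union>i\<in>(P - {a, b}) - {e, f}. set (clean_pair i))" by blast
    have "set C \<inter> (\<Union>i\<in>(P - {a, b}) - {e, f}. set (clean_pair i)) = {}"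
      using C(1) less.prems(4) ab by blast
    then have "set C \<inter> set (concat Js) = {}" using *(7) by blast
    then have d: "distinct (concat (C # Js))" using dC *(6) by simp
    have s: "set (concat (C # Js)) \<subseteq> (\<Union>i\<in>P - {e, f}. set (clean_pair i))"
    proof -
      have "set (concat Js) \<subseteq> (\<Union>i\<in>P - {e, f}. set (clean_pair i))" using *(7) by blast
      moreover have "set C \<subseteq> (\<Union>i\<in>P - {e, f}. set (clean_pair i))" using C(1) ab *(1,2) by blast
      ultimately show ?thesis by simp
    qed
    have l: "length (C # Js) = (card P - 2) div 2" using *(4) cab False by simp
    show ?thesis using * C d s l by (intro exI[of _ e] exI[of _ f] exI[of _ "C # Js"]) simp
  qed
qed

text \<open>Two neighbouring edges whose common vertex would be needed by both are merged into the configuration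
  \<open>[b\<^sub>i, a\<^sub>i\<^sub>+\<^sub>1, b\<^sub>i\<^sub>+\<^sub>1]\<close> (list \<open>Ms\<close>); of the remaining edges, those without a distinguished clean pair are
  configurations by themselves (list \<open>Ds\<close>). The alternatives for \<open>inj\<close> cover a complete cycle, where
  \<open>v 0 = v (2r)\<close> and only one of these two positions may be used.\<close>

lemma decomposition:
  assumes inj: "inj_on v {..2 * r} \<or>
    inj_on v {1..2 * r} \<and> (right_clean 0 \<or> 1 < r \<and> \<not> left_clean 0 \<and> \<not> right_clean 1) \<or>
    inj_on v {..<2 * r} \<and> left_clean (r - 1)"
  obtains Ms Ds P where
    "distinct (concat (Ms @ Ds))" "\<And>C. C \<in> set (Ms @ Ds) \<Longrightarrow> small E W C"
    "finite P" "\<And>i. i \<in> P \<Longrightarrow> i < r \<and> (left_clean i \<or> right_clean i)"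
    "\<And>i j. i \<in> P \<Longrightarrow> j \<in> P \<Longrightarrow> i \<noteq> j \<Longrightarrow> set (clean_pair i) \<inter> set (clean_pair j) = {}"
    "inj_on v (\<Union>i\<in>P. set (clean_pair i))"
    "set (concat (Ms @ Ds)) \<inter> v ` (\<Union>i\<in>P. set (clean_pair i)) = {}"
    "set (concat (Ms @ Ds)) \<subseteq> v ` {..2 * r}"
    "2 * length Ms + length Ds + card P = r"
    "\<And>i. i < r \<Longrightarrow> i \<in> P \<or> (\<exists>C\<in>set (Ms @ Ds).
      {bad E W (v (2 * i)) (v (2 * i + 1)), bad E W (v (2 * i + 1)) (v (2 * i + 2))} \<inter>
      {side1 E W C, side2 E W C} \<noteq> {})"
proof -
  \<comment> \<open>Edge \<open>i\<close> may need its last vertex, and so may edge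
    \<open>i + 1\<close>, where it is the first. Both pairs that meet there then have at most one
    bad vertex each, which makes the merged triple small.\<close>
  define d where "d i \<longleftrightarrow> \<not> left_clean i \<and> \<not> right_clean (Suc i)" for i
  obtain M S where MS: "M \<subseteq> {i. Suc i < r}" "S \<subseteq> {..<r}" "M \<inter> S = {}" "Suc ` M \<inter> S = {}"
    "M \<inter> Suc ` M = {}" "2 * card M + card S = r" "\<forall>i\<in>M. d i"
    "\<forall>i\<in>S. Suc i \<in> S \<longrightarrow> \<not> d i" "1 < r \<and> d 0 \<longrightarrow> 0 \<in> M"
    using greedy_matching[of r d] by (elim exE conjE)
  define pos where "pos i = (if i \<in> M then [2 * i + 1, 2 * i + 2, 2 * i + 3] else
    if left_clean i \<or> right_clean i then clean_pair i else [2 * i, 2 * i + 1, 2 * i + 2])" for i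
  have fin: "finite M" "finite S"
    using MS(1,2) by (auto intro!: finite_subset[of M "{..<r}"] finite_subset[of S "{..<r}"])
  \<comment> \<open>Only position \<open>2 * j\<close> with \<open>j = i + 1\<close> can be shared.
    If two single edges both used it, \<open>d i\<close> would hold, which the matching
    excludes.\<close>
  have disj_less: "set (pos i) \<inter> set (pos j) = {}" if "i \<in> M \<union> S" "j \<in> M \<union> S" "i < j" for i j
  proof (rule ccontr)
    assume "set (pos i) \<inter> set (pos j) \<noteq> {}"
    then obtain x where x: "x \<in> set (pos i)" "x \<in> set (pos j)" by blast
    have "x \<le> 2 * i + 3" using x(1) by (auto simp: pos_def clean_pair_def split: if_splits)
    moreover have "2 * j \<le> x" using x(2) by (auto simp: pos_def clean_pair_def split: if_splits)
    ultimately have j: "j = Suc i" using \<open>i < j\<close> by linarith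
    have iS: "i \<in> S" "i \<notin> M" using that j MS(3,4,5) by auto
    have "x \<le> 2 * i + 2" using x(1) iS by (auto simp: pos_def clean_pair_def split: if_splits)
    then have x2: "x = 2 * j" using \<open>2 * j \<le> x\<close> j by linarith
    have jS: "j \<in> S" "j \<notin> M" using x(2) that(2) by (auto simp: x2 pos_def)
    have "\<not> left_clean i" using x(1) iS j by (auto simp: x2 pos_def clean_pair_def)
    moreover have "\<not> right_clean j"
    proof
      assume "right_clean j"
      moreover from this have "\<not> left_clean j" using not_left_right_clean[of j] jS MS(2) by auto
      ultimately show False using x(2) jS by (auto simp: x2 pos_def clean_pair_def)
    qed
    ultimately show False using bspec[OF MS(8) iS(1)] jS(1) j by (simp add: d_def)
  qed
  have disj: "set (pos i) \<inter> set (pos j) = {}" if "i \<in> M \<union> S" "j \<in> M \<union> S" "i \<noteq> j" for i j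
    using disj_less[of i j] disj_less[of j i] that by (metis Int_commute nat_neq_iff)
  let ?U = "\<Union>i\<in>M \<union> S. set (pos i)"
  have U: "?U \<subseteq> {..2 * r}"
    using MS(1,2) by (force simp: pos_def clean_pair_def split: if_splits)
  \<comment> \<open>Position \<open>0\<close> is used only by an unmatched edge \<open>0\<close>
    that is not right clean. In the second alternative \<open>d 0\<close> holds, so edge
    \<open>0\<close> is matched, and its merged triple starts at position \<open>1\<close>.\<close>
  have U0: "0 \<notin> ?U" if "right_clean 0 \<or> 1 < r \<and> \<not> left_clean 0 \<and> \<not> right_clean 1"
  proof
    assume "0 \<in> ?U"
    then obtain i where i: "i \<in> M \<union> S" "0 \<in> set (pos i)" by blast
    then have "i = 0" "0 \<notin> M" by (auto simp: pos_def clean_pair_def split: if_splits)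
    then have "0 \<in> S" "right_clean 0" using i that MS(9) by (auto simp: d_def)
    then show False using i not_left_right_clean[of 0] MS(2) by (auto simp: pos_def clean_pair_def \<open>i = 0\<close> \<open>0 \<notin> M\<close> split: if_splits)
  qed
  have Ur: "2 * r \<notin> ?U" if "left_clean (r - 1)"
  proof
    assume "2 * r \<in> ?U"
    then obtain i where i: "i \<in> M \<union> S" "2 * r \<in> set (pos i)" by blast
    have "i \<notin> M" using i MS(1) by (auto simp: pos_def)
    then have "i = r - 1" using i MS(2) by (auto simp: pos_def clean_pair_def split: if_splits)
    then show False using i \<open>i \<notin> M\<close> that MS(2) by (auto simp: pos_def clean_pair_def split: if_splits)
  qed
  have injU: "inj_on v ?U"
    using inj
  proof (elim disjE conjE)
    assume "inj_on v {..2 * r}"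
    then show ?thesis using U by (rule inj_on_subset)
  next
    assume a: "inj_on v {..<2 * r}" "left_clean (r - 1)"
    have "?U \<subseteq> {..2 * r} - {2 * r}" using U Ur[OF a(2)] by blast
    also have "\<dots> = {..<2 * r}" by auto
    finally have "?U \<subseteq> {..<2 * r}" .
    then show ?thesis using a(1) by (rule inj_on_subset[rotated])
  next
    assume a: "inj_on v {1..2 * r}" "right_clean 0"
    have "0 \<notin> ?U" using a(2) by (intro U0) blast
    then have "?U \<subseteq> {..2 * r} - {0}" using U by blast
    also have "\<dots> = {1..2 * r}" by auto
    finally have "?U \<subseteq> {1..2 * r}" .
    then show ?thesis using a(1) by (rule inj_on_subset[rotated])
  next
    assume a: "inj_on v {1..2 * r}" "1 < r" "\<not> left_clean 0" "\<not> right_clean 1"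
    have "0 \<notin> ?U" using a(2-4) by (intro U0) blast
    then have "?U \<subseteq> {..2 * r} - {0}" using U by blast
    also have "\<dots> = {1..2 * r}" by auto
    finally have "?U \<subseteq> {1..2 * r}" .
    then show ?thesis using a(1) by (rule inj_on_subset[rotated])
  qed
  define P where "P = {i \<in> S. left_clean i \<or> right_clean i}"
  define D where "D = S - P"
  have finPD: "finite P" "finite D" using fin by (auto simp: P_def D_def)
  have PM: "P \<inter> M = {}" "D \<inter> M = {}" using MS(3) by (auto simp: P_def D_def)
  have posP: "pos i = clean_pair i" if "i \<in> P" for i
    using that PM by (auto simp: P_def pos_def)
  let ?is = "sorted_list_of_set M" and ?js = "sorted_list_of_set D"
  let ?Ms = "map (\<lambda>i. map v (pos i)) ?is" and ?Ds = "map (\<lambda>i. map v (pos i)) ?js"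
  have cc: "concat (?Ms @ ?Ds) = map v (concat (map pos (?is @ ?js)))"
    by (simp add: map_concat comp_def)
  have sub: "set (concat (map pos (?is @ ?js))) = (\<Union>i\<in>M \<union> D. set (pos i))"
    using fin finPD by auto
  have subP: "(\<Union>i\<in>P. set (clean_pair i)) = (\<Union>i\<in>P. set (pos i))" using posP by simp
  have small_conf: "small E W (map v (pos i))" if "i \<in> M \<union> D" for i
  proof (cases "i \<in> M")
    case True
    then show ?thesis using bspec[OF MS(7) True]
      by (auto simp: small_def side1_def side2_def pos_def d_def left_clean_def right_clean_def numeral_3_eq_3)
  next
    case False
    then have "\<not> left_clean i" "\<not> right_clean i" using that by (auto simp: D_def P_def)
    then show ?thesis using False
      by (auto simp: small_def side1_def side2_def pos_def left_clean_def right_clean_def)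
  qed
  have "card S = card P + card D"
    using fin finPD unfolding D_def by (subst card_Diff_subset) (auto simp: P_def card_mono)
  show thesis
  proof (rule that[of ?Ms ?Ds P])
    have "distinct (concat (map pos (?is @ ?js)))"
    proof (rule distinct_concat)
      have "inj_on pos (M \<union> D)"
      proof (rule inj_onI, rule ccontr)
        fix i j assume "i \<in> M \<union> D" "j \<in> M \<union> D" "pos i = pos j" "i \<noteq> j"
        then have "set (pos i) = {}" using disj[of i j] by (auto simp: D_def)
        then show False by (simp add: pos_def clean_pair_def split: if_splits)
      qed
      moreover have "distinct (?is @ ?js)" "set (?is @ ?js) = M \<union> D" using fin finPD PM by auto
      ultimately show "distinct (map pos (?is @ ?js))"
        by (simp only: distinct_map)
      fix ys assume "ys \<in> set (map pos (?is @ ?js))"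
      then show "distinct ys" by (auto simp: pos_def clean_pair_def)
      fix zs assume "zs \<in> set (map pos (?is @ ?js))" "ys \<noteq> zs"
      then show "set ys \<inter> set zs = {}"
        using disj \<open>ys \<in> _\<close> fin finPD unfolding D_def by (smt (verit) DiffD1 Un_iff imageE set_append set_map set_sorted_list_of_set)
    qed
    then show "distinct (concat (?Ms @ ?Ds))"
      unfolding cc distinct_map sub
      using injU by (auto simp: D_def elim: inj_on_subset)
    show "small E W C" if "C \<in> set (?Ms @ ?Ds)" for C
      using that small_conf fin finPD by auto
    show "set (clean_pair i) \<inter> set (clean_pair j) = {}" if "i \<in> P" "j \<in> P" "i \<noteq> j" for i j
      using disj[of i j] that posP by (auto simp: P_def)
    show "inj_on v (\<Union>i\<in>P. set (clean_pair i))"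
      unfolding subP by (rule inj_on_subset[OF injU]) (auto simp: P_def)
    have PDdisj: "(\<Union>i\<in>M \<union> D. set (pos i)) \<inter> (\<Union>i\<in>P. set (pos i)) = {}"
    proof -
      have "set (pos i) \<inter> set (pos j) = {}" if "i \<in> M \<union> D" "j \<in> P" for i j
        using disj[of i j] that PM by (auto simp: P_def D_def)
      then show ?thesis by blast
    qed
    have "v ` (\<Union>i\<in>M \<union> D. set (pos i)) \<inter> v ` (\<Union>i\<in>P. set (pos i)) = {}"
    proof -
      have "(\<Union>i\<in>M \<union> D. set (pos i)) \<subseteq> ?U" "(\<Union>i\<in>P. set (pos i)) \<subseteq> ?U"
        by (auto simp: P_def D_def)
      from inj_on_image_Int[OF injU this] show ?thesis using PDdisj by simp
    qed
    then show "set (concat (?Ms @ ?Ds)) \<inter> v ` (\<Union>i\<in>P. set (clean_pair i)) = {}"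
      unfolding cc set_map sub subP .
    show "set (concat (?Ms @ ?Ds)) \<subseteq> v ` {..2 * r}"
      unfolding cc set_map sub using U by (intro image_mono) (auto simp: D_def)
    show "2 * length ?Ms + length ?Ds + card P = r"
      using MS(6) \<open>card S = card P + card D\<close> by simp
    \<comment> \<open>Counting shows that every edge is single or in a matched pair. The merged
      triple shows the second pair of its left edge and the first pair of its right edge, hence one
      bad set of each.\<close>
    have "card (M \<union> Suc ` M \<union> S) = r"
      using fin MS(3-6) by (subst card_Un_disjoint; auto simp: card_image card_Un_disjoint)
    then have cover: "M \<union> Suc ` M \<union> S = {..<r}"
      using MS(1,2) by (intro card_subset_eq) auto
    fix i assume "i < r"
    then consider "i \<in> P" | "i \<in> D" | "i \<in> M" | j where "i = Suc j" "j \<in> M"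
      using cover D_def by blast
    then show "i \<in> P \<or> (\<exists>C\<in>set (?Ms @ ?Ds).
      {bad E W (v (2 * i)) (v (2 * i + 1)), bad E W (v (2 * i + 1)) (v (2 * i + 2))} \<inter>
      {side1 E W C, side2 E W C} \<noteq> {})"
    proof cases
      case 2
      then have "side1 E W (map v (pos i)) = bad E W (v (2 * i)) (v (2 * i + 1))"
        using PM by (auto simp: pos_def D_def P_def side1_def)
      then show ?thesis using 2 fin finPD by auto
    next
      case 3
      then have "side1 E W (map v (pos i)) = bad E W (v (2 * i + 1)) (v (2 * i + 2))"
        by (auto simp: pos_def side1_def)
      then show ?thesis using 3 fin finPD by auto
    next
      case 4
      then have "side2 E W (map v (pos j)) = bad E W (v (2 * i)) (v (2 * i + 1))"
        by (auto simp: pos_def side2_def numeral_3_eq_3)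
      then show ?thesis using 4 fin finPD by auto
    qed simp
  qed (use finPD MS(2) in \<open>auto simp: P_def\<close>)
qed

end

text \<open>In \<open>x\<^sub>0, C\<^sub>1, x\<^sub>1, C\<^sub>2, \<dots>\<close> a configuration \<open>C = [p, q, s]\<close> between \<open>x\<close> and \<open>y\<close> stands for the edges
  \<open>{x, p, q}\<close> and \<open>{q, s, y}\<close>. Hence \<open>x\<^sub>i\<close> has to avoid the second side of \<open>C\<^sub>i\<close> and the first side of
  \<open>C\<^sub>i\<^sub>+\<^sub>1\<close>.\<close>

fun weave :: "'a list \<Rightarrow> 'a list list \<Rightarrow> 'a list" where
  "weave (x # xs) (C # Cs) = x # C @ weave xs Cs"
| "weave xs [] = xs"
| "weave [] (C # Cs) = []"

text \<open>\<open>F\<close> and \<open>G\<close> are the vertices excluded from the first and the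
  last place by whatever is attached outside the chain.\<close>

fun forbidden :: "('a set \<Rightarrow> bool) \<Rightarrow> 'a set \<Rightarrow> 'a set \<Rightarrow> 'a list list \<Rightarrow> 'a set \<Rightarrow> 'a set list" where
  "forbidden E W F [] G = [F \<union> G]"
| "forbidden E W F (C # Cs) G = (F \<union> side1 E W C) # forbidden E W (side2 E W C) Cs G"

lemma length_forbidden [simp]: "length (forbidden E W F Cs G) = Suc (length Cs)"
  by (induction Cs arbitrary: F) auto

lemma forbidden_snoc: "forbidden E W F (Cs @ [C]) G = forbidden E W F Cs (side1 E W C) @ [side2 E W C \<union> G]"
  by (induction Cs arbitrary: F) auto

lemma set_weave: "length xs = Suc (length Cs) \<Longrightarrow> set (weave xs Cs) = set xs \<union> set (concat Cs)"
  by (induction xs Cs rule: weave.induct) auto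

lemma distinct_weave:
  "length xs = Suc (length Cs) \<Longrightarrow> distinct (xs @ concat Cs) \<Longrightarrow> distinct (weave xs Cs)"
  by (induction xs Cs rule: weave.induct) (auto simp: set_weave)

lemma length_weave:
  "length xs = Suc (length Cs) \<Longrightarrow> (\<And>C. C \<in> set Cs \<Longrightarrow> length C = 3) \<Longrightarrow>
    length (weave xs Cs) = 4 * length Cs + 1"
  by (induction xs Cs rule: weave.induct) auto

lemma hd_weave: "xs \<noteq> [] \<Longrightarrow> hd (weave xs Cs) = hd xs"
  by (induction xs Cs rule: weave.induct) auto

lemma last_weave: "length xs = Suc (length Cs) \<Longrightarrow> last (weave xs Cs) = last xs"
proof (induction xs Cs rule: weave.induct)
  case (1 x xs C Cs)
  then have "weave xs Cs \<noteq> []" "xs \<noteq> []" by (cases xs; cases Cs; auto)+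
  then show ?case using 1 by simp
qed auto

lemma lpath_weave:
  assumes "list_all2 (\<lambda>x B. x \<in> W \<and> x \<notin> B) xs (forbidden E W F Cs G)"
    and "\<And>C. C \<in> set Cs \<Longrightarrow> length C = 3"
  shows "lpath (\<lambda>e. \<not> E e) (weave xs Cs) \<and> hd xs \<notin> F \<and> last xs \<notin> G"
  using assms
proof (induction Cs arbitrary: xs F)
  case Nil
  then show ?case by (auto simp: list_all2_Cons2)
next
  case (Cons C Cs)
  then obtain x ys where xs: "xs = x # ys" "x \<in> W" "x \<notin> F" "x \<notin> side1 E W C"
    and ys: "list_all2 (\<lambda>x B. x \<in> W \<and> x \<notin> B) ys (forbidden E W (side2 E W C) Cs G)"
    by (auto simp: list_all2_Cons2)
  obtain y zs where y: "ys = y # zs" "y \<in> W" using ys by (cases Cs) (auto simp: list_all2_Cons2)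
  obtain p q s where C: "C = [p, q, s]"
    using Cons.prems(2)[of C] by (auto simp: numeral_3_eq_3 length_Suc_conv)
  have IH: "lpath (\<lambda>e. \<not> E e) (weave ys Cs)" "y \<notin> side2 E W C" "last ys \<notin> G"
    using Cons.IH[OF ys] Cons.prems(2) y by auto
  obtain us where us: "weave ys Cs = y # us" using y by (cases Cs) auto
  have "\<not> E {x, p, q}" "\<not> E {q, s, y}"
    using xs y IH(2) by (auto simp: side1_def side2_def bad_def C insert_commute)
  then show ?case using IH xs y us by (simp add: C)
qed

text \<open>A greedy choice from the end of the list: when the representative for
  \<open>Bs ! i\<close> is chosen, only the later ones are taken. Places that exclude little should
  therefore stand in front.\<close>

lemma distinct_representatives:
  assumes "finite W" "\<And>B. B \<in> set Bs \<Longrightarrow> finite B"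
    and "\<And>i. i < length Bs \<Longrightarrow> card (Bs ! i) + (length Bs - Suc i) < card W"
  shows "\<exists>xs. distinct xs \<and> list_all2 (\<lambda>x B. x \<in> W \<and> x \<notin> B) xs Bs"
  using assms(2,3)
proof (induction Bs)
  case (Cons B Bs)
  have "\<exists>xs. distinct xs \<and> list_all2 (\<lambda>x B. x \<in> W \<and> x \<notin> B) xs Bs"
  proof (rule Cons.IH)
    fix i assume "i < length Bs"
    then show "card (Bs ! i) + (length Bs - Suc i) < card W"
      using Cons.prems(2)[of "Suc i"] by simp
  qed (use Cons.prems in auto)
  then obtain xs where xs: "distinct xs" "list_all2 (\<lambda>x B. x \<in> W \<and> x \<notin> B) xs Bs" by blast
  have "card (B \<union> set xs) \<le> card B + length xs"
    by (rule order_trans[OF card_Un_le]) (simp add: card_length)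
  also have "length xs = length Bs" using xs(2) by (rule list_all2_lengthD)
  also have "card B + length Bs < card W" using Cons.prems(2)[of 0] by simp
  finally obtain x where "x \<in> W" "x \<notin> B \<union> set xs"
    using ex_not_in[of "B \<union> set xs" W] Cons.prems(1)[of B] by auto
  with xs show ?case by (intro exI[of _ "x # xs"]) simp
qed simp

lemma list_all2_subset: "list_all2 (\<lambda>x B. x \<in> W \<and> x \<notin> B) xs Bs \<Longrightarrow> set xs \<subseteq> W"
  by (induction rule: list_all2_induct) auto

lemma finite_sides [simp]:
  assumes "finite W"
  shows "finite (bad E W p q)" "finite (side1 E W C)" "finite (side2 E W C)"
  using assms finite_subset[OF bad_subset] by (auto simp: side1_def side2_def)

lemma finite_forbidden:
  assumes "finite W" "finite F" "finite G" "B \<in> set (forbidden E W F Cs G)"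
  shows "finite B"
  using assms(2,4)
proof (induction Cs arbitrary: F)
  case (Cons C Cs)
  then show ?case
    using Cons.IH[of "side2 E W C"] assms(1) by auto
qed (simp add: assms(3))

lemma card_Un_le': "card A \<le> m \<Longrightarrow> card B \<le> n \<Longrightarrow> card (A \<union> B) \<le> m + n"
  by (rule order_trans[OF card_Un_le]) simp

lemma card_forbidden_joint:
  assumes "\<And>C. C \<in> set Js \<Longrightarrow> joint E W C" "card F \<le> 2" "B \<in> set (forbidden E W F Js {})"
  shows "card B \<le> 2"
  using assms by (induction Js arbitrary: F) (auto simp: joint_def)

text \<open>The order matters: two small sides meet in at most \<open>1 + 1\<close> vertices, and
  every first side of a joint is empty. A joint followed by a small configuration could exclude
  three vertices.\<close>

lemma card_forbidden:
  assumes "\<And>C. C \<in> set Ss \<Longrightarrow> small E W C" "\<And>C. C \<in> set Js \<Longrightarrow> joint E W C"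
    and "card F \<le> 1" "card G \<le> 1" "Js \<noteq> [] \<Longrightarrow> G = {}" "B \<in> set (forbidden E W F (Ss @ Js) G)"
  shows "card B \<le> 2"
  using assms
proof (induction Ss arbitrary: F)
  case Nil
  show ?case
  proof (cases "Js = []")
    case True
    then show ?thesis using Nil.prems card_Un_le'[of F 1 G 1] by simp
  next
    case False
    then show ?thesis using Nil.prems card_forbidden_joint[of Js E W F B] by simp
  qed
next
  case (Cons C Ss)
  have C: "card (side1 E W C) \<le> 1" "card (side2 E W C) \<le> 1"
    using Cons.prems(1)[of C] by (auto simp: small_def)
  show ?case
  proof (cases "B = F \<union> side1 E W C")
    case True
    then show ?thesis using card_Un_le'[OF Cons.prems(3) C(1)] by simp
  next
    case False
    then have "B \<in> set (forbidden E W (side2 E W C) (Ss @ Js) G)" using Cons.prems(6) by simp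
    then show ?thesis using Cons.IH[of "side2 E W C"] Cons.prems C by simp
  qed
qed

lemma lpath_ends:
  assumes "lpath E xs" "E {p, q, hd xs}" "E {last xs, s, t}"
  shows "lpath E ([p, q] @ xs @ [s, t])"
proof -
  have odd: "odd (length xs)" using assms(1) by (rule lpath_odd)
  obtain ys y where xs: "xs = ys @ [y]" using odd by (cases xs rule: rev_cases) auto
  have "lpath E (ys @ y # [s, t])"
    using odd assms xs lpath_append[of ys E y "[s, t]"] by simp
  moreover obtain z zs where "xs = z # zs" using odd by (cases xs) auto
  ultimately show ?thesis using assms(2) xs by (cases ys) auto
qed

text \<open>One vertex of \<open>W\<close> stays spare. Every place excludes at most two vertices,
  and the first place, filled last, at most one because the clean pair \<open>p, p'\<close>
  contributes nothing; so the greedy choice succeeds.\<close>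

lemma path_with_ends:
  assumes W: "finite W" "card W = length (Ss @ Js) + 2"
    and Ss: "\<And>C. C \<in> set Ss \<Longrightarrow> small E W C" and Js: "\<And>C. C \<in> set Js \<Longrightarrow> joint E W C"
    and p: "bad E W p p' = {}" and q: "card (bad E W q q') \<le> 1" "Js \<noteq> [] \<Longrightarrow> bad E W q q' = {}"
    and dist: "distinct ([p, p', q, q'] @ concat (Ss @ Js))"
    and disj: "set ([p, p', q, q'] @ concat (Ss @ Js)) \<inter> W = {}"
  shows "\<exists>vs. lpath (\<lambda>e. \<not> E e) vs \<and> distinct vs \<and> length vs = 4 * length (Ss @ Js) + 5 \<and>
    set vs \<subseteq> W \<union> set ([p, p', q, q'] @ concat (Ss @ Js))"
proof -
  let ?Cs = "Ss @ Js" and ?F = "bad E W p p'" and ?G = "bad E W q q'"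
  let ?Bs = "forbidden E W ?F ?Cs ?G"
  have c2: "card B \<le> 2" if "B \<in> set ?Bs" for B
    by (rule card_forbidden[OF Ss Js _ q that]) (auto simp: p)
  have c1: "card (?Bs ! 0) \<le> 1"
  proof (cases ?Cs)
    case Nil
    then show ?thesis using q p by simp
  next
    case (Cons C Cs)
    then have "C \<in> set ?Cs" by simp
    then have "small E W C \<or> joint E W C" using Ss Js by auto
    then show ?thesis using Cons p by (auto simp: small_def joint_def)
  qed
  have "\<exists>xs. distinct xs \<and> list_all2 (\<lambda>x B. x \<in> W \<and> x \<notin> B) xs ?Bs"
  proof (rule distinct_representatives)
    fix i assume i: "i < length ?Bs"
    show "card (?Bs ! i) + (length ?Bs - Suc i) < card W"
      using c1 c2[of "?Bs ! i"] i W by (cases i) auto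
  next
    fix B assume "B \<in> set ?Bs"
    then show "finite B" by (rule finite_forbidden[rotated -1]) (use W in auto)
  qed (rule W)
  then obtain xs where xs: "distinct xs" "list_all2 (\<lambda>x B. x \<in> W \<and> x \<notin> B) xs ?Bs" by blast
  have len: "length xs = Suc (length ?Cs)" using list_all2_lengthD[OF xs(2)] by simp
  have l3: "length C = 3" if "C \<in> set ?Cs" for C
    using that Ss[of C] Js[of C] by (auto simp: small_def joint_def)
  have sub: "set xs \<subseteq> W" using list_all2_subset[OF xs(2)] .
  note lp = lpath_weave[OF xs(2) l3]
  have ne: "xs \<noteq> []" using len by auto
  let ?vs = "[p, p'] @ weave xs ?Cs @ [q, q']"
  have "hd (weave xs ?Cs) = hd xs" "last (weave xs ?Cs) = last xs"
    using hd_weave[OF ne] last_weave[OF len] by auto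
  moreover have "hd xs \<in> W" "last xs \<in> W" using sub ne by auto
  ultimately have "lpath (\<lambda>e. \<not> E e) ?vs"
    using lp by (intro lpath_ends) (auto simp: bad_def insert_commute)
  moreover have "distinct ?vs"
  proof -
    have B: "set xs \<inter> set (concat ?Cs) = {}" "set [p, p', q, q'] \<inter> set xs = {}"
      using sub disj unfolding set_append by blast+
    have D: "distinct [p, p', q, q']" "distinct (concat ?Cs)" "set [p, p', q, q'] \<inter> set (concat ?Cs) = {}"
      using dist unfolding distinct_append by blast+
    have "distinct (weave xs ?Cs)"
      by (rule distinct_weave[OF len]) (simp only: distinct_append xs(1) B(1) D(2))
    moreover have "set (weave xs ?Cs) \<inter> set [p, p', q, q'] = {}"
      unfolding set_weave[OF len] using B D by blast
    ultimately show ?thesis using D(1) by auto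
  qed
  moreover have "length ?vs = 4 * length ?Cs + 5"
    using length_weave[OF len l3] by simp
  moreover have "set ?vs \<subseteq> W \<union> set ([p, p', q, q'] @ concat ?Cs)"
    using set_weave[OF len] sub by auto
  ultimately show ?thesis by blast
qed


text \<open>Here all of \<open>W\<close> is used. The inner places are filled greedily, which leaves
  two vertices for the two outer places; as these exclude at most one vertex each, and not the same
  one, one of the two assignments works.\<close>

lemma path_small:
  assumes W: "finite W" "card W = length Cs + 1" and Cs: "\<And>C. C \<in> set Cs \<Longrightarrow> small E W C"
    and ends: "Cs = C1 # Rs @ [C2]" "side1 E W C1 \<inter> side2 E W C2 = {}"
    and dist: "distinct (concat Cs)" and disj: "set (concat Cs) \<inter> W = {}"
  shows "\<exists>vs. lpath (\<lambda>e. \<not> E e) vs \<and> distinct vs \<and> length vs = 4 * length Cs + 1 \<and>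
    set vs \<subseteq> W \<union> set (concat Cs)"
proof -
  let ?A = "side1 E W C1" and ?B = "side2 E W C2"
  let ?Bs = "forbidden E W (side2 E W C1) Rs (side1 E W C2)"
  have C12: "card ?A \<le> 1" "card (side2 E W C1) \<le> 1" "card (side1 E W C2) \<le> 1" "card ?B \<le> 1"
    using Cs[of C1] Cs[of C2] by (auto simp: ends(1) small_def)
  have c2: "card B \<le> 2" if "B \<in> set ?Bs" for B
    by (rule card_forbidden[where Js = "[]" and Ss = Rs, OF Cs _ C12(2,3)]) (use that in \<open>auto simp: ends(1)\<close>)
  have "\<exists>ys. distinct ys \<and> list_all2 (\<lambda>x B. x \<in> W \<and> x \<notin> B) ys ?Bs"
  proof (rule distinct_representatives)
    fix i assume i: "i < length ?Bs"
    then have "card (?Bs ! i) \<le> 2" by (intro c2) simp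
    then show "card (?Bs ! i) + (length ?Bs - Suc i) < card W"
      using i W by (simp add: ends(1))
  next
    fix B assume "B \<in> set ?Bs"
    then show "finite B" by (rule finite_forbidden[rotated -1]) (use W in auto)
  qed (rule W)
  then obtain ys where ys: "distinct ys" "list_all2 (\<lambda>x B. x \<in> W \<and> x \<notin> B) ys ?Bs" by blast
  have sub: "set ys \<subseteq> W" using list_all2_subset[OF ys(2)] .
  have "length ys = Suc (length Rs)" using list_all2_lengthD[OF ys(2)] by simp
  then have "card (W - set ys) = 2"
    using W sub ys(1) by (subst card_Diff_subset) (auto simp: distinct_card ends(1))
  then obtain u u' where u: "W - set ys = {u, u'}" "u \<noteq> u'" by (auto simp: card_2_iff)
  have one: "x = y" if "card S \<le> 1" "x \<in> S" "y \<in> S" "finite S" for x y :: 'a and S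
    using that card_le_Suc0_iff_eq[of S] by auto
  have "\<exists>x z. x \<in> W - set ys \<and> z \<in> W - set ys \<and> x \<noteq> z \<and> x \<notin> ?A \<and> z \<notin> ?B"
  proof (cases "u \<notin> ?A \<and> u' \<notin> ?B")
    case True
    then show ?thesis using u by blast
  next
    case False
    then have "u' \<notin> ?A \<and> u \<notin> ?B"
      using u(2) one[OF C12(1), of u u'] one[OF C12(4), of u u'] ends(2) W(1) by auto
    then show ?thesis using u by blast
  qed
  then obtain x z where xz: "x \<in> W - set ys" "z \<in> W - set ys" "x \<noteq> z" "x \<notin> ?A" "z \<notin> ?B" by blast
  let ?xs = "x # ys @ [z]"
  have "forbidden E W {} Cs {} = ?A # ?Bs @ [?B]"
    by (simp add: ends(1) forbidden_snoc)
  then have la: "list_all2 (\<lambda>x B. x \<in> W \<and> x \<notin> B) ?xs (forbidden E W {} Cs {})"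
    using ys(2) xz by (auto intro!: list_all2_appendI)
  have len: "length ?xs = Suc (length Cs)" using list_all2_lengthD[OF la] by simp
  have l3: "length C = 3" if "C \<in> set Cs" for C
    using Cs[OF that] by (auto simp: small_def)
  have "lpath (\<lambda>e. \<not> E e) (weave ?xs Cs)" using lpath_weave[OF la l3] by blast
  moreover have "distinct (weave ?xs Cs)"
  proof (rule distinct_weave[OF len])
    have "set ?xs \<subseteq> W" using sub xz by auto
    moreover have "distinct ?xs" using ys(1) xz by auto
    ultimately show "distinct (?xs @ concat Cs)"
      using dist disj unfolding distinct_append by blast
  qed
  moreover have "length (weave ?xs Cs) = 4 * length Cs + 1" by (rule length_weave[OF len l3])
  moreover have "set (weave ?xs Cs) \<subseteq> W \<union> set (concat Cs)"
    using set_weave[OF len] sub xz by auto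
  ultimately show ?thesis by blast
qed

lemma length3_rev:
  assumes "length C = 3"
  shows "side1 E W (rev C) = side2 E W C" "side2 E W (rev C) = side1 E W C"
  using assms by (auto simp: side1_def side2_def bad_commute numeral_3_eq_3 length_Suc_conv)

lemma small_rev: "small E W C \<Longrightarrow> small E W (rev C)"
  by (simp add: small_def length3_rev)

text \<open>Only if all sides are the same singleton is it impossible to choose the two outer sides of
  the chain disjoint.\<close>

lemma path_small_or_constant:
  assumes W: "finite W" "card W = k + 1" and k: "2 \<le> k" "k \<le> length Cs"
    and Cs: "\<And>C. C \<in> set Cs \<Longrightarrow> small E W C"
    and dist: "distinct (concat Cs)" and disj: "set (concat Cs) \<inter> W = {}"
  shows "(\<exists>vs. lpath (\<lambda>e. \<not> E e) vs \<and> distinct vs \<and> length vs = 4 * k + 1 \<and>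
      set vs \<subseteq> W \<union> set (concat Cs)) \<or>
    (\<exists>w\<in>W. \<forall>C\<in>set Cs. side1 E W C = {w} \<and> side2 E W C = {w})"
proof (cases "\<exists>X Y. X \<in> set Cs \<and> Y \<in> set Cs \<and> X \<noteq> Y \<and>
    (\<exists>a\<in>{side1 E W X, side2 E W X}. \<exists>b\<in>{side1 E W Y, side2 E W Y}. a \<inter> b = {})")
  case True
  then obtain X Y a b where XY: "X \<in> set Cs" "Y \<in> set Cs" "X \<noteq> Y"
    "a \<in> {side1 E W X, side2 E W X}" "b \<in> {side1 E W Y, side2 E W Y}" "a \<inter> b = {}" by blast
  have l3: "length C = 3" if "C \<in> set Cs" for C using Cs[OF that] by (simp add: small_def)
  obtain C1 where C1: "C1 = X \<or> C1 = rev X" "side1 E W C1 = a"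
    using XY(4) that[of X] that[of "rev X"] length3_rev(1)[OF l3[OF XY(1)], of E W] by auto
  obtain C2 where C2: "C2 = Y \<or> C2 = rev Y" "side2 E W C2 = b"
    using XY(5) that[of Y] that[of "rev Y"] length3_rev(2)[OF l3[OF XY(2)], of E W] by auto
  have dCs: "distinct Cs"
  proof -
    have "[] \<notin> set Cs" using l3 by force
    then show ?thesis using dist by (simp add: distinct_concat_iff removeAll_id)
  qed
  have dj: "set C \<inter> set D = {}" if "C \<in> set Cs" "D \<in> set Cs" "C \<noteq> D" for C D
    using dist that by (auto simp: distinct_concat_iff)
  \<comment> \<open>\<open>X\<close> and \<open>Y\<close>, suitably reversed, become the outer
    configurations, so \<open>k - 2\<close> others are needed between them.\<close>
  define Rs where "Rs = take (k - 2) (remove1 X (remove1 Y Cs))"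
  have Rs_sub: "set Rs \<subseteq> set Cs - {X, Y}"
    using dCs unfolding Rs_def by (auto dest!: in_set_takeD simp: set_remove1_eq)
  have dRs: "distinct Rs" using dCs by (simp add: Rs_def)
  have lRs: "length Rs = k - 2"
    using k XY by (simp add: Rs_def length_remove1)
  let ?Ds = "C1 # Rs @ [C2]"
  have s12: "set C1 = set X" "set C2 = set Y" using C1 C2 by auto
  have "small E W C1" "small E W C2" using C1 C2 XY Cs small_rev by blast+
  then have small: "small E W C" if "C \<in> set ?Ds" for C using that Rs_sub Cs by auto
  have "distinct (concat Rs)"
  proof (rule distinct_concat[OF dRs])
    fix ys assume ys: "ys \<in> set Rs"
    then show "distinct ys" using Rs_sub dist by (auto simp: distinct_concat_iff)
    fix zs assume "zs \<in> set Rs" "ys \<noteq> zs"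
    then show "set ys \<inter> set zs = {}" using Rs_sub ys by (intro dj) auto
  qed
  moreover have "set X \<inter> set (concat Rs) = {}" "set Y \<inter> set (concat Rs) = {}"
    using dj XY(1,2) Rs_sub by fastforce+
  moreover have "distinct C1" "distinct C2"
    using C1 C2 dist XY by (auto simp: distinct_concat_iff)
  ultimately have dDs: "distinct (concat ?Ds)" using dj[OF XY(1-3)] s12 by auto
  have sub: "set (concat ?Ds) \<subseteq> set (concat Cs)"
    using s12 Rs_sub XY by auto
  have len: "length ?Ds = k" using lRs k by simp
  have "\<exists>vs. lpath (\<lambda>e. \<not> E e) vs \<and> distinct vs \<and> length vs = 4 * length ?Ds + 1 \<and>
      set vs \<subseteq> W \<union> set (concat ?Ds)"
  proof (rule path_small[OF W(1) _ small refl _ dDs])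
    show "card W = length ?Ds + 1" using len W(2) by simp
    show "side1 E W C1 \<inter> side2 E W C2 = {}" using C1 C2 XY by simp
    show "set (concat ?Ds) \<inter> W = {}" using sub disj by blast
  qed
  then obtain vs where "lpath (\<lambda>e. \<not> E e) vs" "distinct vs" "length vs = 4 * length ?Ds + 1"
    "set vs \<subseteq> W \<union> set (concat ?Ds)" by blast
  moreover from this(4) sub have "set vs \<subseteq> W \<union> set (concat Cs)" by blast
  ultimately show ?thesis unfolding len by blast
next
  case False
  have l2: "length Cs \<ge> 2" using k by simp
  then obtain X Y Zs where Cs_eq: "Cs = X # Y # Zs" by (cases Cs; cases "tl Cs") auto
  have XY: "X \<in> set Cs" "Y \<in> set Cs" by (auto simp: Cs_eq)
  have ne: "X \<noteq> Y" using dist Cs[OF XY(1)] by (auto simp: Cs_eq small_def)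
  have meet: "a \<inter> b \<noteq> {}" if "C \<in> set Cs" "D \<in> set Cs" "C \<noteq> D"
    "a \<in> {side1 E W C, side2 E W C}" "b \<in> {side1 E W D, side2 E W D}" for C D a b
    using False that by blast
  have sing: "a = b" if "C \<in> set Cs" "D \<in> set Cs" "C \<noteq> D"
    "a \<in> {side1 E W C, side2 E W C}" "b \<in> {side1 E W D, side2 E W D}" for C D a b
  proof -
    have fin: "card a \<le> 1" "card b \<le> 1" "finite a" "finite b"
      using that Cs[of C] Cs[of D] W(1) by (auto simp: small_def)
    have "a \<inter> b \<noteq> {}" by (rule meet[OF that])
    then obtain z where z: "z \<in> a" "z \<in> b" by blast
    have "a = {z}" using fin(1,3) z(1) card_le_Suc0_iff_eq[of a] by auto
    moreover have "b = {z}" using fin(2,4) z(2) card_le_Suc0_iff_eq[of b] by auto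
    ultimately show ?thesis by simp
  qed
  obtain w where w: "w \<in> side1 E W X" using meet[OF XY ne, of "side1 E W X" "side1 E W Y"] by auto
  have X1: "side1 E W X = {w}"
  proof -
    have "card (side1 E W X) \<le> 1" using Cs[OF XY(1)] by (simp add: small_def)
    then show ?thesis using w W(1) card_le_Suc0_iff_eq[of "side1 E W X"] by auto
  qed
  have Y: "side1 E W Y = {w}" "side2 E W Y = {w}" using sing[OF XY ne, of "side1 E W X"] X1 by auto
  have "side1 E W C = {w} \<and> side2 E W C = {w}" if "C \<in> set Cs" for C
  proof (cases "C = Y")
    case True
    then show ?thesis using Y by simp
  next
    case False
    then show ?thesis
      using sing[OF that XY(2) False, of "side1 E W C" "side1 E W Y"]
        sing[OF that XY(2) False, of "side2 E W C" "side1 E W Y"] Y by simp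
  qed
  moreover have "w \<in> W" using w bad_subset by (fastforce simp: side1_def)
  ultimately show ?thesis by blast
qed

text \<open>Serves the case in which every side is the same singleton: once that vertex is removed
  from \<open>W\<close>, all pairs of neighbouring positions are clean and \<open>k\<close> vertices
  suffice.\<close>

lemma path_all_clean:
  fixes v :: "nat \<Rightarrow> 'a"
  assumes W: "finite W" "card W = k" and k: "0 < k"
    and clean: "\<And>i. i < 2 * k \<Longrightarrow> bad E W (v (2 * i)) (v (2 * i + 1)) = {}"
      "\<And>i. i < 2 * k \<Longrightarrow> bad E W (v (2 * i + 1)) (v (2 * i + 2)) = {}"
    and inj: "inj_on v {..<4 * k}" and disj: "v ` {..<4 * k} \<inter> W = {}"
  shows "\<exists>vs. lpath (\<lambda>e. \<not> E e) vs \<and> distinct vs \<and> length vs = 4 * k + 1 \<and>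
    set vs \<subseteq> v ` {..<4 * k} \<union> W"
proof -
  obtain x where x: "bij_betw x {..<k} W"
    using ex_bij_betw_nat_finite[OF W(1)] W(2) by (auto simp: atLeast0LessThan)
  have xW: "x j \<in> W" if "j < k" for j using x that by (auto simp: bij_betw_def)
  \<comment> \<open>The path is \<open>v 0, v 1, x 0, v 3, v 4, v 5, x 1, v 7, ...\<close>, with
    every position congruent to 2 modulo 4 handed to \<open>W\<close>. At the end
    \<open>v (4 * k)\<close> could coincide with \<open>v 0\<close>, so the skipped vertex
    \<open>v (4 * k - 2)\<close> takes its place; it forms a clean pair with
    \<open>v (4 * k - 1)\<close> as well.\<close>
  define u where "u n = (if n mod 4 = 2 then x (n div 4) else if n = 4 * k then v (4 * k - 2) else v n)" for n
  have edge: "\<not> E {u (2 * i), u (2 * i + 1), u (2 * i + 2)}" if i: "i < 2 * k" for i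
  proof (cases "even i")
    case True
    then obtain j where j: "i = 2 * j" by (elim evenE)
    have "(2 * i) mod 4 \<noteq> 2" "(2 * i + 1) mod 4 \<noteq> 2" "2 * i + 1 \<noteq> 4 * k" "2 * i \<noteq> 4 * k"
      "(2 * i + 2) mod 4 = 2" "(2 * i + 2) div 4 = j"
      using i j by presburger+
    then have "u (2 * i) = v (2 * i)" "u (2 * i + 1) = v (2 * i + 1)" "u (2 * i + 2) = x j"
      by (simp_all add: u_def)
    then show ?thesis
      using clean(1)[OF i] xW[of j] i by (auto simp: bad_def j)
  next
    case False
    then obtain j where j: "i = 2 * j + 1" by (elim oddE)
    have "(2 * i) mod 4 = 2" "(2 * i) div 4 = j" "(2 * i + 1) mod 4 \<noteq> 2" "2 * i + 1 \<noteq> 4 * k"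
      "(2 * i + 2) mod 4 \<noteq> 2" "2 * i + 2 = 4 * k \<longleftrightarrow> i = 2 * k - 1"
      "2 * i + 2 = 4 * k \<longrightarrow> 4 * k - 2 = 2 * i"
      using i j by presburger+
    then have "u (2 * i) = x j" "u (2 * i + 1) = v (2 * i + 1)"
      "u (2 * i + 2) = (if i = 2 * k - 1 then v (2 * i) else v (2 * i + 2))"
      by (simp_all add: u_def)
    moreover have "x j \<in> W" using xW i j by simp
    ultimately show ?thesis
      using clean(1)[OF i] clean(2)[OF i]
      by (cases "i = 2 * k - 1") (auto simp: bad_def insert_commute simp del: One_nat_def)
  qed
  let ?vs = "map u [0..<4 * k + 1]"
  have "lpath (\<lambda>e. \<not> E e) ?vs"
    unfolding lpath_nth using edge by (auto simp del: upt_Suc)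
  moreover have "inj_on u {..<4 * k + 1}"
  proof (rule inj_onI)
    define s where "s n = (if n = 4 * k then 4 * k - 2 else n)" for n
    have cases: "(n mod 4 = 2 \<and> u n = x (n div 4) \<and> n div 4 < k) \<or>
        (n mod 4 \<noteq> 2 \<and> u n = v (s n) \<and> s n < 4 * k)"
      if "n < 4 * k + 1" for n
      using that k by (auto simp: u_def s_def)
    fix m n assume mn: "m \<in> {..<4 * k + 1}" "n \<in> {..<4 * k + 1}" "u m = u n"
    have no: "x a \<noteq> v b" if "a < k" "b < 4 * k" for a b
      using disj xW that by (metis IntI empty_iff image_eqI lessThan_iff)
    have xi: "a = b" if "x a = x b" "a < k" "b < k" for a b
      using x that by (auto simp: bij_betw_def inj_on_def)
    have vi: "a = b" if "v a = v b" "a < 4 * k" "b < 4 * k" for a b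
      using inj that by (auto simp: inj_on_def)
    have sinj: "a = b" if "s a = s b" "a mod 4 \<noteq> 2" "b mod 4 \<noteq> 2" "a < 4 * k + 1" "b < 4 * k + 1" for a b
    proof -
      have "s c = 4 * k - 2 \<and> c = 4 * k \<or> s c = c \<and> s c \<noteq> 4 * k - 2" if "c mod 4 \<noteq> 2" for c
      proof (cases "c = 4 * k")
        case False
        obtain k' where "k = Suc k'" using k by (cases k) auto
        then have "4 * k - 2 = 4 * k' + 2" by simp
        moreover have "(4 * k' + 2) mod 4 = 2" by presburger
        ultimately have "c \<noteq> 4 * k - 2" using \<open>c mod 4 \<noteq> 2\<close> by metis
        then show ?thesis using False by (simp add: s_def)
      qed (simp add: s_def)
      from this[OF that(2)] this[OF that(3)] show ?thesis using that(1) by metis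
    qed
    have m: "m < 4 * k + 1" and n: "n < 4 * k + 1" using mn by auto
    show "m = n"
    proof (cases "m mod 4 = 2"; cases "n mod 4 = 2")
      assume *: "m mod 4 = 2" "n mod 4 = 2"
      then have "m div 4 = n div 4" using xi cases[OF m] cases[OF n] mn(3) by simp
      then show ?thesis using * by (metis div_mult_mod_eq)
    next
      assume *: "m mod 4 \<noteq> 2" "n mod 4 \<noteq> 2"
      then have "s m = s n" using vi cases[OF m] cases[OF n] mn(3) by simp
      then show ?thesis using sinj * m n by simp
    next
      assume "m mod 4 = 2" "n mod 4 \<noteq> 2"
      then show ?thesis using no[of "m div 4" "s n"] cases[OF m] cases[OF n] mn(3) by simp
    next
      assume "m mod 4 \<noteq> 2" "n mod 4 = 2"
      then show ?thesis using no[of "n div 4" "s m"] cases[OF m] cases[OF n] mn(3) by simp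
    qed
  qed
  then have "distinct ?vs" by (simp add: distinct_map atLeast0LessThan del: upt_Suc)
  moreover have "set ?vs \<subseteq> v ` {..<4 * k} \<union> W"
  proof -
    have "u n \<in> v ` {..<4 * k} \<union> W" if "n < 4 * k + 1" for n
      using that k xW[of "n div 4"] by (auto simp: u_def)
    then have "u ` {..<4 * k + 1} \<subseteq> v ` {..<4 * k} \<union> W" by blast
    then show ?thesis by (simp only: set_map set_upt atLeast0LessThan)
  qed
  ultimately show ?thesis by (intro exI[of _ ?vs]) simp
qed

lemma distinct_concat_take: "distinct (concat xs) \<Longrightarrow> distinct (concat (take n xs))"
  by (metis append_take_drop_id concat_append distinct_append)

lemma set_concat_take: "set (concat (take n xs)) \<subseteq> set (concat xs)"
  by (auto dest: in_set_takeD)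

text \<open>The required \<open>2 * k\<close> edges come from \<open>k - 1\<close> configurations
  and two end pairs, or from \<open>k\<close> configurations without end pairs. The number of
  distinguished clean pairs decides which: two serve as both ends, one as a single end, and with
  none the chain of small configurations is used.\<close>

lemma (in segment) complement_path:
  assumes k: "2 \<le> k" "r = 2 * k" "card W = k + 1" and disj: "v ` {..2 * r} \<inter> W = {}"
    and inj: "inj_on v {..2 * r} \<or>
      inj_on v {1..2 * r} \<and> (right_clean 0 \<or> 1 < r \<and> \<not> left_clean 0 \<and> \<not> right_clean 1) \<or>
      inj_on v {..<2 * r} \<and> left_clean (r - 1)"
    and inj': "inj_on v {..<2 * r}"
  shows "\<exists>vs. lpath (\<lambda>e. \<not> E e) vs \<and> distinct vs \<and> length vs = 4 * k + 1 \<and>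
    set vs \<subseteq> v ` {..2 * r} \<union> W"
proof -
  obtain Ms Ds P where dist: "distinct (concat (Ms @ Ds))"
    and small: "\<And>C. C \<in> set (Ms @ Ds) \<Longrightarrow> small E W C"
    and P: "finite P" "\<And>i. i \<in> P \<Longrightarrow> i < r \<and> (left_clean i \<or> right_clean i)"
      "\<And>i j. i \<in> P \<Longrightarrow> j \<in> P \<Longrightarrow> i \<noteq> j \<Longrightarrow> set (clean_pair i) \<inter> set (clean_pair j) = {}"
      "inj_on v (\<Union>i\<in>P. set (clean_pair i))"
    and CP: "set (concat (Ms @ Ds)) \<inter> v ` (\<Union>i\<in>P. set (clean_pair i)) = {}"
    and sub: "set (concat (Ms @ Ds)) \<subseteq> v ` {..2 * r}"
    and count: "2 * length Ms + length Ds + card P = r"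
    and cover: "\<And>i. i < r \<Longrightarrow> i \<in> P \<or> (\<exists>C\<in>set (Ms @ Ds).
      {bad E W (v (2 * i)) (v (2 * i + 1)), bad E W (v (2 * i + 1)) (v (2 * i + 2))} \<inter>
      {side1 E W C, side2 E W C} \<noteq> {})"
    using decomposition[OF inj] by blast
  have pr_eq: "clean_pair i = [clean_pair i ! 0, clean_pair i ! 1]" for i by (simp add: clean_pair_def)
  have pr_dist: "distinct (clean_pair i)" for i by (simp add: clean_pair_def)
  have pr_sub: "set (clean_pair i) \<subseteq> {..2 * r}" if "i \<in> P" for i
    using P(2)[OF that] by (auto simp: clean_pair_def)
  have CW: "set (concat (Ms @ Ds)) \<inter> W = {}" using sub disj by blast
  consider "2 \<le> card P" | "card P = 1" | "card P = 0" by linarith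
  then show ?thesis
  proof cases
    case 1
    obtain e f Js where J: "e \<in> P" "f \<in> P" "e \<noteq> f" "length Js = (card P - 2) div 2"
      "\<forall>C\<in>set Js. joint E W (map v C)" "distinct (concat Js)"
      "set (concat Js) \<subseteq> (\<Union>i\<in>P - {e, f}. set (clean_pair i))"
      using joins[OF P(1) 1 P(2,3)] by blast
    define Ss' where "Ss' = take (k - 1) (Ms @ Ds)"
    define Js' where "Js' = take (k - 1 - length Ss') Js"
    \<comment> \<open>If \<open>card P\<close> is odd, one clean pair is lost in joining. But then
      \<open>Ds\<close> has odd length, and a member of \<open>Ds\<close> is worth two edges
      although it takes only one, which makes up for the loss.\<close>
    have len: "length Ss' + length Js' = k - 1"
      using count k 1 J(4) by (auto simp: Ss'_def Js'_def min_def)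
    have pos: "distinct (clean_pair e @ clean_pair f @ concat Js')"
      "set (clean_pair e @ clean_pair f @ concat Js') \<subseteq> (\<Union>i\<in>P. set (clean_pair i))"
    proof -
      have s: "set (concat Js') \<subseteq> (\<Union>i\<in>P - {e, f}. set (clean_pair i))"
        using J(7) set_concat_take[of _ Js] unfolding Js'_def by blast
      then show "set (clean_pair e @ clean_pair f @ concat Js') \<subseteq> (\<Union>i\<in>P. set (clean_pair i))"
        using J(1,2) by auto
      have "set (clean_pair e) \<inter> set (concat Js') = {}" "set (clean_pair f) \<inter> set (concat Js') = {}"
        using s P(3) J(1,2) by blast+
      then show "distinct (clean_pair e @ clean_pair f @ concat Js')"
        using pr_dist P(3)[OF J(1-3)] distinct_concat_take[OF J(6)] unfolding Js'_def by auto
    qed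
    let ?Js = "map (map v) Js'"
    have a: "distinct (map v (clean_pair e @ clean_pair f @ concat Js'))"
      using pos inj_on_subset[OF P(4)] by (simp only: distinct_map)
    have b: "map v (clean_pair e @ clean_pair f @ concat Js') =
      [v (clean_pair e ! 0), v (clean_pair e ! 1), v (clean_pair f ! 0), v (clean_pair f ! 1)] @ concat ?Js"
      by (subst pr_eq[of e], subst pr_eq[of f]) (simp add: map_concat)
    have c: "set (map v (clean_pair e @ clean_pair f @ concat Js')) \<subseteq> v ` (\<Union>i\<in>P. set (clean_pair i))"
      using pos(2) by (simp only: set_map image_mono)
    note pos' = a[unfolded b] c[unfolded b]
    have sS: "set (concat Ss') \<subseteq> set (concat (Ms @ Ds))"
      unfolding Ss'_def by (rule set_concat_take)
    have dS: "distinct (concat Ss')" unfolding Ss'_def using dist by (rule distinct_concat_take)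
    have PU: "v ` (\<Union>i\<in>P. set (clean_pair i)) \<subseteq> v ` {..2 * r}" using pr_sub by (intro image_mono) blast
    have all: "set ([v (clean_pair e ! 0), v (clean_pair e ! 1), v (clean_pair f ! 0), v (clean_pair f ! 1)] @ concat (Ss' @ ?Js)) \<subseteq> v ` {..2 * r}"
      using pos'(2) sS sub PU unfolding concat_append set_append by blast
    have "\<exists>vs. lpath (\<lambda>e. \<not> E e) vs \<and> distinct vs \<and> length vs = 4 * length (Ss' @ ?Js) + 5 \<and>
      set vs \<subseteq> W \<union> set ([v (clean_pair e ! 0), v (clean_pair e ! 1), v (clean_pair f ! 0), v (clean_pair f ! 1)] @ concat (Ss' @ ?Js))"
    proof (rule path_with_ends[OF finite_W])
      show "card W = length (Ss' @ ?Js) + 2" using k len by simp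
      show "small E W C" if "C \<in> set Ss'" for C
        using that small unfolding Ss'_def by (blast dest: in_set_takeD)
      show "joint E W C" if "C \<in> set ?Js" for C
        using that J(5) unfolding Js'_def by (auto dest: in_set_takeD)
      show "bad E W (v (clean_pair e ! 0)) (v (clean_pair e ! 1)) = {}" using bad_clean_pair P(2) J(1) by blast
      have f: "bad E W (v (clean_pair f ! 0)) (v (clean_pair f ! 1)) = {}" using bad_clean_pair P(2) J(2) by blast
      then show "card (bad E W (v (clean_pair f ! 0)) (v (clean_pair f ! 1))) \<le> 1" by simp
      show "bad E W (v (clean_pair f ! 0)) (v (clean_pair f ! 1)) = {}" by (rule f)
      show "distinct ([v (clean_pair e ! 0), v (clean_pair e ! 1), v (clean_pair f ! 0), v (clean_pair f ! 1)] @ concat (Ss' @ ?Js))"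
        using pos' dS sS CP unfolding concat_append distinct_append set_append by blast
      show "set ([v (clean_pair e ! 0), v (clean_pair e ! 1), v (clean_pair f ! 0), v (clean_pair f ! 1)] @ concat (Ss' @ ?Js)) \<inter> W = {}"
        using all disj by blast
    qed
    then obtain vs where "lpath (\<lambda>e. \<not> E e) vs" "distinct vs" "length vs = 4 * length (Ss' @ ?Js) + 5"
      "set vs \<subseteq> W \<union> set ([v (clean_pair e ! 0), v (clean_pair e ! 1), v (clean_pair f ! 0), v (clean_pair f ! 1)] @ concat (Ss' @ ?Js))"
      by blast
    moreover have "length vs = 4 * k + 1" using \<open>length vs = _\<close> len k by simp
    moreover have "set vs \<subseteq> v ` {..2 * r} \<union> W" using \<open>set vs \<subseteq> _\<close> all by blast
    ultimately show ?thesis by blast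
  next
    case 2
    then obtain e where e: "P = {e}" by (auto simp: card_1_singleton_iff)
    \<comment> \<open>By parity a member of \<open>Ds\<close> exists; its first two vertices form
      the second end, which may exclude one vertex since no joints are used.\<close>
    have "odd (length Ds)" using count 2 k by presburger
    then obtain D Ds' where D: "Ds = D # Ds'" by (cases Ds) auto
    have sD: "small E W D" using small by (simp add: D)
    then obtain d0 d1 d2 where Dl: "D = [d0, d1, d2]"
      by (auto simp: small_def numeral_3_eq_3 length_Suc_conv)
    define Ss' where "Ss' = take (k - 1) (Ms @ Ds')"
    have len: "length Ss' = k - 1"
      using count k 2 D by (auto simp: Ss'_def min_def)
    have sS: "set (concat Ss') \<subseteq> set (concat (Ms @ Ds'))"
      unfolding Ss'_def by (rule set_concat_take)
    have "distinct (concat (Ms @ Ds'))" using dist by (auto simp: D)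
    then have dS: "distinct (concat Ss')" unfolding Ss'_def by (rule distinct_concat_take)
    have de: "distinct [v (clean_pair e ! 0), v (clean_pair e ! 1)]"
      using P(4) pr_dist[of e] pr_eq[of e] by (auto simp: e inj_on_def clean_pair_def)
    have ve: "{v (clean_pair e ! 0), v (clean_pair e ! 1)} = v ` (\<Union>i\<in>P. set (clean_pair i))"
      by (auto simp: e clean_pair_def)
    have all: "set ([v (clean_pair e ! 0), v (clean_pair e ! 1), d0, d1] @ concat (Ss' @ [])) \<subseteq> v ` {..2 * r}"
    proof -
      have "set (concat (Ms @ Ds')) \<subseteq> set (concat (Ms @ Ds))" "{d0, d1} \<subseteq> set (concat (Ms @ Ds))"
        by (auto simp: D Dl)
      then have "set (concat Ss') \<subseteq> v ` {..2 * r}" "{d0, d1} \<subseteq> v ` {..2 * r}"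
        using sS sub by blast+
      moreover have "{v (clean_pair e ! 0), v (clean_pair e ! 1)} \<subseteq> v ` {..2 * r}"
        using pr_sub[of e] by (auto simp: e clean_pair_def split: if_splits)
      ultimately show ?thesis by simp
    qed
    have "\<exists>vs. lpath (\<lambda>e. \<not> E e) vs \<and> distinct vs \<and> length vs = 4 * length (Ss' @ []) + 5 \<and>
      set vs \<subseteq> W \<union> set ([v (clean_pair e ! 0), v (clean_pair e ! 1), d0, d1] @ concat (Ss' @ []))"
    proof (rule path_with_ends[OF finite_W])
      show "card W = length (Ss' @ []) + 2" using k len by simp
      show "small E W C" if "C \<in> set Ss'" for C
        using that small unfolding Ss'_def by (auto simp: D dest: in_set_takeD)
      show "bad E W (v (clean_pair e ! 0)) (v (clean_pair e ! 1)) = {}" using bad_clean_pair P(2) e by blast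
      show "card (bad E W d0 d1) \<le> 1" using sD by (simp add: small_def side1_def Dl)
      have "distinct [d0, d1]" "set [d0, d1] \<inter> set (concat (Ms @ Ds')) = {}"
        using dist by (auto simp: D Dl)
      moreover have "set [d0, d1] \<union> set (concat (Ms @ Ds')) \<subseteq> set (concat (Ms @ Ds))"
        by (auto simp: D Dl)
      then have "{v (clean_pair e ! 0), v (clean_pair e ! 1)} \<inter> (set [d0, d1] \<union> set (concat (Ms @ Ds'))) = {}"
        unfolding ve using CP by blast
      ultimately have "distinct [v (clean_pair e ! 0), v (clean_pair e ! 1), d0, d1]"
        "set [v (clean_pair e ! 0), v (clean_pair e ! 1), d0, d1] \<inter> set (concat (Ms @ Ds')) = {}"
        using de by auto
      then show "distinct ([v (clean_pair e ! 0), v (clean_pair e ! 1), d0, d1] @ concat (Ss' @ []))"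
        using dS sS unfolding distinct_append append_Nil2 by blast
      show "set ([v (clean_pair e ! 0), v (clean_pair e ! 1), d0, d1] @ concat (Ss' @ [])) \<inter> W = {}"
        using all disj by blast
    qed auto
    then obtain vs where "lpath (\<lambda>e. \<not> E e) vs" "distinct vs" "length vs = 4 * length (Ss' @ []) + 5"
      "set vs \<subseteq> W \<union> set ([v (clean_pair e ! 0), v (clean_pair e ! 1), d0, d1] @ concat (Ss' @ []))"
      by blast
    moreover have "length vs = 4 * k + 1" using \<open>length vs = _\<close> len k by simp
    moreover have "set vs \<subseteq> v ` {..2 * r} \<union> W" using \<open>set vs \<subseteq> _\<close> all by blast
    ultimately show ?thesis by blast
  next
    case 3
    then have "P = {}" using P(1) by simp
    have lk: "k \<le> length (Ms @ Ds)" using count k 3 by simp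
    from path_small_or_constant[OF finite_W k(3,1) lk small dist CW] show ?thesis
    proof
      assume "\<exists>vs. lpath (\<lambda>e. \<not> E e) vs \<and> distinct vs \<and> length vs = 4 * k + 1 \<and>
        set vs \<subseteq> W \<union> set (concat (Ms @ Ds))"
      then obtain vs where "lpath (\<lambda>e. \<not> E e) vs" "distinct vs" "length vs = 4 * k + 1"
        "set vs \<subseteq> W \<union> set (concat (Ms @ Ds))" by blast
      moreover have "set vs \<subseteq> v ` {..2 * r} \<union> W" using \<open>set vs \<subseteq> _\<close> sub by blast
      ultimately show ?thesis by blast
    next
      assume "\<exists>w\<in>W. \<forall>C\<in>set (Ms @ Ds). side1 E W C = {w} \<and> side2 E W C = {w}"
      then obtain w where w: "w \<in> W" "\<And>C. C \<in> set (Ms @ Ds) \<Longrightarrow> side1 E W C = {w} \<and> side2 E W C = {w}"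
        by blast
      have AB: "bad E W (v (2 * i)) (v (2 * i + 1)) \<subseteq> {w} \<and> bad E W (v (2 * i + 1)) (v (2 * i + 2)) \<subseteq> {w}"
        if "i < r" for i
      proof -
        have "bad E W (v (2 * i)) (v (2 * i + 1)) = {w} \<or> bad E W (v (2 * i + 1)) (v (2 * i + 2)) = {w}"
          using cover[OF that] w(2) \<open>P = {}\<close> by fastforce
        then show ?thesis using swap[OF that] by blast
      qed
      have bW: "bad E (W - {w}) p q = bad E W p q - {w}" for p q by (auto simp: bad_def)
      have vk: "v ` {..<4 * k} \<subseteq> v ` {..2 * r}" using k by (intro image_mono) auto
      have "\<exists>vs. lpath (\<lambda>e. \<not> E e) vs \<and> distinct vs \<and> length vs = 4 * k + 1 \<and>
        set vs \<subseteq> v ` {..<4 * k} \<union> (W - {w})"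
      proof (rule path_all_clean)
        show "v ` {..<4 * k} \<inter> (W - {w}) = {}" using vk disj by blast
        show "card (W - {w}) = k" using w(1) k finite_W by simp
        fix i assume "i < 2 * k"
        then have "i < r" using k by simp
        from AB[OF this] show "bad E (W - {w}) (v (2 * i)) (v (2 * i + 1)) = {}"
          "bad E (W - {w}) (v (2 * i + 1)) (v (2 * i + 2)) = {}"
          unfolding bW by blast+
      next
        show "inj_on v {..<4 * k}" using inj' k by simp
      qed (use k finite_W in auto)
      then obtain vs where "lpath (\<lambda>e. \<not> E e) vs" "distinct vs" "length vs = 4 * k + 1"
        "set vs \<subseteq> v ` {..<4 * k} \<union> (W - {w})" by blast
      moreover from this(4) vk have "set vs \<subseteq> v ` {..2 * r} \<union> W" by blast
      ultimately show ?thesis by blast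
    qed
  qed
qed

section \<open>Extending cycles and closing paths\<close>

definition path_in :: "('a set \<Rightarrow> bool) \<Rightarrow> 'a set \<Rightarrow> nat \<Rightarrow> bool" where
  "path_in E V m \<longleftrightarrow> (\<exists>vs. lpath E vs \<and> distinct vs \<and> length vs = 2 * m + 1 \<and> set vs \<subseteq> V)"

definition cycle_in :: "('a set \<Rightarrow> bool) \<Rightarrow> 'a set \<Rightarrow> nat \<Rightarrow> bool" where
  "cycle_in E V n \<longleftrightarrow> (\<exists>vs. lpath E vs \<and> hd vs = last vs \<and> distinct (tl vs) \<and>
    length vs = 2 * n + 1 \<and> set vs \<subseteq> V)"

lemma lpath_replace:
  assumes "lpath E (as @ a # s @ b # bs)" "lpath E (a # s' @ [b])" "even (length as)" "odd (length s)"
  shows "lpath E (as @ a # s' @ b # bs)"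
proof -
  have 1: "lpath E (as @ [a])" "lpath E (a # s @ b # bs)"
    using lpath_appendD[OF assms(1,3)] by auto
  have "lpath E ((a # s) @ b # bs)" using 1(2) by simp
  then have 2: "lpath E (b # bs)" by (rule lpath_appendD) (use assms(4) in simp)
  have "even (length (a # s'))" using lpath_odd[OF assms(2)] by simp
  then have "lpath E ((a # s') @ b # bs)" using lpath_append[of "a # s'" E b bs] assms(2) 2 by simp
  then show ?thesis using lpath_append[OF assms(3), of E a "s' @ b # bs"] 1(1) by simp
qed

lemma lpath_take:
  assumes "lpath E xs" "2 * m + 1 \<le> length xs"
  shows "lpath E (take (2 * m + 1) xs)"
  using assms by (auto simp: lpath_nth)

lemma path_in_mono:
  assumes "path_in E V m" "m' \<le> m"
  shows "path_in E V m'"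
proof -
  obtain vs where "lpath E vs" "distinct vs" "length vs = 2 * m + 1" "set vs \<subseteq> V"
    using assms(1) by (auto simp: path_in_def)
  then show ?thesis
    unfolding path_in_def
    using assms(2) lpath_take[of E vs m']
    by (intro exI[of _ "take (2 * m' + 1) vs"]) (auto dest: in_set_takeD)
qed

lemma cycle_replace:
  assumes L: "L = as @ a # s @ b # bs" "lpath E L" "hd L = last L" "distinct (tl L)"
    and s': "lpath E (a # s' @ [b])" "distinct s'" "set s' \<subseteq> set s \<union> W"
    and W: "W \<inter> set L = {}" and par: "even (length as)" "odd (length s)"
  shows "lpath E (as @ a # s' @ b # bs) \<and> hd (as @ a # s' @ b # bs) = last (as @ a # s' @ b # bs) \<and>
    distinct (tl (as @ a # s' @ b # bs))"
proof (intro conjI)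
  show "lpath E (as @ a # s' @ b # bs)" using lpath_replace[of E as a s b bs s'] L(1,2) s'(1) par by simp
  show "hd (as @ a # s' @ b # bs) = last (as @ a # s' @ b # bs)"
    using L(3) unfolding L(1) by (cases as) auto
  show "distinct (tl (as @ a # s' @ b # bs))"
    using L(4) s'(2,3) W unfolding L(1) by (cases as) auto
qed

text \<open>Unlike a path, a longer cycle cannot simply be cut down, so the absence of both longer
  cycles is assumed.\<close>

lemma cycle_unextendable:
  assumes L: "lpath E L" "hd L = last L" "distinct (tl L)" "length L = 2 * c + 1" "set L \<subseteq> V" "0 < c"
    and no: "\<not> cycle_in E V (c + 1)" "\<not> cycle_in E V (c + 2)"
    and W: "W \<subseteq> V - set L" "finite W"
  shows "unextendable E L W"
proof
  show "lpath E L" "distinct (tl L)" "finite W" by fact+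
  show WL: "W \<inter> set L = {}" using W by blast
  obtain h t where L_eq: "L = h # t" using L(4) by (cases L) auto
  then have ht: "L = h # t" "t \<noteq> []" using L(4,6) by auto
  have "last t = h" using L(2) ht by simp
  then have "distinct (butlast t @ [h])" using L(3) ht append_butlast_last_id[OF ht(2)] by simp
  then show "distinct (butlast L)" using ht by simp
next
  have WL: "W \<inter> set L = {}" using W by blast
  fix as a s b bs s'
  assume d: "L = as @ a # s @ b # bs" "even (length as)" and s': "lpath E (a # s' @ [b])" "distinct s'"
    "set s' \<subseteq> set s \<union> W" and len: "length s' = length s + 2 \<or> length s' = length s + 4"
  have os: "odd (length s)" using lpath_odd[OF s'(1)] len by auto
  let ?L = "as @ a # s' @ b # bs"
  have "lpath E ?L \<and> hd ?L = last ?L \<and> distinct (tl ?L)"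
    by (rule cycle_replace[OF d(1) L(1-3) s' WL d(2) os])
  moreover have "set ?L \<subseteq> V" using L(5) W(1) s'(3) d(1) by auto
  moreover have "length ?L = 2 * (c + 1) + 1 \<or> length ?L = 2 * (c + 2) + 1"
    using len L(4) d(1) by auto
  ultimately show False using no unfolding cycle_in_def by blast
qed

lemma path_unextendable:
  assumes L: "lpath E L" "distinct L" "length L = 2 * r + 1" "set L \<subseteq> V"
    and no: "\<not> path_in E V (r + 1)"
    and W: "W \<subseteq> V - set L" "finite W"
  shows "unextendable E L W"
proof
  show "lpath E L" "finite W" by fact+
  show "distinct (tl L)" "distinct (butlast L)" using L(2) by (simp_all add: distinct_tl distinct_butlast)
  show WL: "W \<inter> set L = {}" using W by blast
next
  have no2: "\<not> path_in E V (r + 2)" using no path_in_mono[of E V "r + 2" "r + 1"] by auto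
  have WL: "W \<inter> set L = {}" using W by blast
  fix as a s b bs s'
  assume d: "L = as @ a # s @ b # bs" "even (length as)" and s': "lpath E (a # s' @ [b])" "distinct s'"
    "set s' \<subseteq> set s \<union> W" and len: "length s' = length s + 2 \<or> length s' = length s + 4"
  have os: "odd (length s)" using lpath_odd[OF s'(1)] len by auto
  let ?L = "as @ a # s' @ b # bs"
  have "lpath E ?L" using lpath_replace[of E as a s b bs s'] L(1) d s'(1) os by simp
  moreover have "distinct ?L" using L(2) s'(2,3) WL unfolding d(1) by auto
  moreover have "set ?L \<subseteq> V" using L(4) W(1) s'(3) d(1) by auto
  moreover have "length ?L = 2 * (r + 1) + 1 \<or> length ?L = 2 * (r + 2) + 1"
    using len L(3) d(1) by auto
  ultimately show False using no no2 unfolding path_in_def by blast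
qed

text \<open>If a cycle cannot be shortened by one edge, then all triples joining vertices at distance two
  along it have the other colour.\<close>

lemma long_cycle:
  assumes cyc: "cycle_in E V (c + 2)" and no: "\<not> cycle_in E V (c + 1)" and k: "0 < k" "2 * k \<le> c"
  shows "path_in (\<lambda>e. \<not> E e) V (2 * k)"
proof -
  obtain L where L: "lpath E L" "hd L = last L" "distinct (tl L)" "length L = 2 * (c + 2) + 1" "set L \<subseteq> V"
    using cyc by (auto simp: cycle_in_def)
  have skip: "\<not> E {L ! (2 * i), x, L ! (2 * i + 4)}"
    if i: "2 * i + 4 < length L" and x: "x \<in> {L ! (2 * i + 1), L ! (2 * i + 2), L ! (2 * i + 3)}" for i x
  proof
    assume e: "E {L ! (2 * i), x, L ! (2 * i + 4)}"
    let ?as = "take (2 * i) L" and ?bs = "drop (2 * i + 5) L"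
    let ?s = "[L ! (2 * i + 1), L ! (2 * i + 2), L ! (2 * i + 3)]"
    have d: "L = ?as @ L ! (2 * i) # ?s @ L ! (2 * i + 4) # ?bs"
      using i by (simp add: Cons_nth_drop_Suc eval_nat_numeral)
    let ?L = "?as @ L ! (2 * i) # [x] @ L ! (2 * i + 4) # ?bs"
    have "lpath E ?L \<and> hd ?L = last ?L \<and> distinct (tl ?L)"
      by (rule cycle_replace[OF d L(1-3), where W = "{}"]) (use e x i in auto)
    moreover have "length ?L = 2 * (c + 1) + 1" using i L(4) by simp
    moreover have "set ?L \<subseteq> V"
    proof -
      have "set ?L \<subseteq> set L" using x i by (auto dest: in_set_takeD in_set_dropD)
      then show ?thesis using L(5) by blast
    qed
    ultimately show False using no unfolding cycle_in_def by blast
  qed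
  \<comment> \<open>The positions run down through \<open>4 * k, 4 * k - 4, ..., 4\<close>, cross
    over by the triple at positions \<open>4, 0, 2\<close>, and run up through
    \<open>2, 6, ..., 4 * k + 2\<close>. The vertices in between are at positions congruent to 1 on
    the way down and to 3 on the way up. The largest position stays below
    \<open>2 * (c + 2)\<close>, so the repeated last vertex is never reached.\<close>
  define p where "p n = (if n < 2 * k - 1 then (if even n then 4 * k - 2 * n else 4 * k - 2 * n - 1)
    else if n = 2 * k - 1 then 0
    else if even n then 2 * (n - 2 * k) + 2 else 2 * (n - 2 * k) + 1)" for n
  let ?vs = "map (\<lambda>n. L ! p n) [0..<4 * k + 1]"
  have p_less: "p n < 2 * (c + 2)" if "n < 4 * k + 1" for n
    using that k by (auto simp: p_def)
  have "inj_on p {..<4 * k + 1}"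
  proof (rule inj_on_inverseI)
    \<comment> \<open>The inverse of \<open>p\<close>, read off from the residue modulo 4; position
      \<open>0\<close> is the crossing.\<close>
    define g where "g y = (if y = 0 then 2 * k - 1 else if y mod 4 = 0 then (4 * k - y) div 2
      else if y mod 4 = 1 then (4 * k - 1 - y) div 2
      else if y mod 4 = 2 then 2 * k + (y - 2) div 2 else 2 * k + (y - 1) div 2)" for y
    fix a
    consider (1) "a < 2 * k - 1" "even a" | (2) "a < 2 * k - 1" "odd a" | (3) "a = 2 * k - 1"
      | (4) "a \<ge> 2 * k" "even a" | (5) "a \<ge> 2 * k" "odd a" by linarith
    then show "g (p a) = a"
    proof cases
      case 1
      then obtain b where b: "a = 2 * b" by (elim evenE)
      define d where "d = k - b - 1"
      have "p a = 4 * Suc d" "4 * k - 4 * Suc d = 2 * a" using 1 by (auto simp: p_def b d_def)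
      then show ?thesis by (simp add: g_def)
    next
      case 2
      then obtain b where b: "a = 2 * b + 1" by (elim oddE)
      define d where "d = k - b - 1"
      have pa: "p a = 4 * d + 1" and a: "4 * k - 1 - (4 * d + 1) = 2 * a" using 2 by (auto simp: p_def b d_def)
      have "(4 * d + 1) mod 4 = 1" by presburger
      then show ?thesis unfolding pa g_def using a by simp
    next
      case 3
      then show ?thesis using k(1) by (simp add: p_def g_def)
    next
      case 4
      then obtain b where b: "a = 2 * b" by (elim evenE)
      define d where "d = b - k"
      have pa: "p a = 4 * d + 2" and a: "a = 2 * k + 2 * d" using 4 k(1) by (auto simp: p_def b d_def)
      have "(4 * d + 2) mod 4 = 2" by presburger
      then show ?thesis unfolding pa g_def using a by simp
    next
      case 5
      then obtain b where b: "a = 2 * b + 1" by (elim oddE)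
      define d where "d = b - k"
      have pa: "p a = 4 * d + 3" and a: "a = 2 * k + 2 * d + 1" using 5 k(1) by (auto simp: p_def b d_def)
      have "(4 * d + 3) mod 4 = 3" by presburger
      then show ?thesis unfolding pa g_def using a by simp
    qed
  qed
  moreover have "inj_on ((!) L) {..<2 * (c + 2)}"
  proof -
    have "tl L \<noteq> []" using L(4) by (cases L) auto
    then have "distinct (butlast (tl L) @ [last (tl L)])" using L(3) by simp
    then have "distinct (butlast L)"
      using L(2) \<open>tl L \<noteq> []\<close> by (cases L) auto
    then show ?thesis using L(4) by (auto simp: inj_on_def distinct_conv_nth nth_butlast)
  qed
  ultimately have "inj_on (\<lambda>n. L ! p n) {..<4 * k + 1}"
    using p_less by (auto simp: inj_on_def)
  then have "distinct ?vs" by (simp add: distinct_map atLeast0LessThan del: upt_Suc)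
  moreover have "set ?vs \<subseteq> V"
  proof -
    have "L ! p n \<in> V" if "n < 4 * k + 1" for n
      using p_less[OF that] L(4,5) by (auto intro: nth_mem)
    then show ?thesis by (auto simp del: upt_Suc)
  qed
  moreover have "lpath (\<lambda>e. \<not> E e) ?vs"
    unfolding lpath_nth
  proof (intro conjI allI impI)
    fix i assume i: "2 * i + 2 < length ?vs"
    then have i': "i < 2 * k" by simp
    consider "i < k - 1" | "i = k - 1" | j where "i = k + j" "j < k"
    proof -
      have "i = k + (i - k)" "i - k < k" if "\<not> i < k - 1" "i \<noteq> k - 1" using that i' by linarith+
      then show ?thesis using that by blast
    qed
    then have "\<not> E {L ! p (2 * i), L ! p (2 * i + 1), L ! p (2 * i + 2)}"
    proof cases
      case 1
      let ?i = "2 * k - 2 * i - 2"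
      have "p (2 * i) = 2 * ?i + 4" "p (2 * i + 1) = 2 * ?i + 1" "p (2 * i + 2) = 2 * ?i"
        using 1 by (auto simp: p_def)
      then show ?thesis using skip[of ?i "L ! (2 * ?i + 1)"] 1 L(4) k by (simp add: insert_commute)
    next
      case 2
      have "p (2 * i) = 4" "p (2 * i + 1) = 0" "p (2 * i + 2) = 2"
        using 2 k by (auto simp: p_def)
      then show ?thesis using skip[of 0 "L ! 2"] L(4) k by (simp add: insert_commute numeral_2_eq_2)
    next
      case 3
      have "p (2 * i) = 2 * (2 * j + 1)" "p (2 * i + 1) = 2 * (2 * j + 1) + 1" "p (2 * i + 2) = 2 * (2 * j + 1) + 4"
        using 3 k by (auto simp: p_def)
      then show ?thesis using skip[of "2 * j + 1" "L ! (2 * (2 * j + 1) + 1)"] 3 L(4) k by simp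
    qed
    then show "\<not> E {?vs ! (2 * i), ?vs ! (2 * i + 1), ?vs ! (2 * i + 2)}"
      using i by (simp del: upt_Suc)
  qed simp
  ultimately show ?thesis unfolding path_in_def by (intro exI[of _ ?vs]) simp
qed

lemma inj_on_nth_interval:
  assumes "distinct (tl L)" "0 < m" "b < length L"
  shows "inj_on ((!) L) {m..b}"
proof (rule inj_onI)
  fix i j assume ij: "i \<in> {m..b}" "j \<in> {m..b}" "L ! i = L ! j"
  then have "tl L ! (i - 1) = tl L ! (j - 1)" "i - 1 < length (tl L)" "j - 1 < length (tl L)"
    using assms(2,3) by (auto simp: nth_tl)
  then have "i - 1 = j - 1" using assms(1) nth_eq_iff_index_eq by blast
  then show "i = j" using ij assms(2) by auto
qed

lemma inj_on_nth_lessThan: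
  assumes "distinct (butlast L)"
  shows "inj_on ((!) L) {..<length L - 1}"
  using assms by (auto simp: inj_on_def distinct_conv_nth nth_butlast)

lemma closed_nth:
  assumes "hd L = last L" "length L = 2 * c + 1"
  shows "L ! (2 * c) = L ! 0"
proof -
  have "L \<noteq> []" using assms(2) by auto
  then show ?thesis using assms by (simp add: hd_conv_nth last_conv_nth)
qed

text \<open>Moving the last edge to the front lets the two edges at the former seam be merged.\<close>

lemma rotate_cycle:
  assumes L: "lpath E L" "hd L = last L" "distinct (tl L)" "distinct (butlast L)" "length L = 2 * c + 1" "0 < c"
  defines "L' \<equiv> L ! (2 * c - 2) # L ! (2 * c - 1) # take (2 * c - 1) L"
  shows "lpath E L' \<and> hd L' = last L' \<and> distinct (tl L') \<and> length L' = length L \<and> set L' \<subseteq> set L"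
proof -
  have last: "L ! (2 * c) = L ! 0"
    using closed_nth[OF L(2,5)] .
  have len: "length L' = length L" using L(5,6) by (simp add: L'_def)
  have nth: "L' ! (i + 2) = L ! i" if "i < 2 * c - 1" for i
    using that by (simp add: L'_def)
  have "lpath E L'"
    unfolding lpath_nth
  proof (intro conjI allI impI)
    show "odd (length L')" using len L(5) by simp
    fix i assume i: "2 * i + 2 < length L'"
    show "E {L' ! (2 * i), L' ! (2 * i + 1), L' ! (2 * i + 2)}"
    proof (cases i)
      case 0
      have "2 * (c - 1) + 2 < length L" using L(5,6) by simp
      then have "E {L ! (2 * (c - 1)), L ! (2 * (c - 1) + 1), L ! (2 * (c - 1) + 2)}"
        using L(1) unfolding lpath_nth by blast
      moreover have "2 * (c - 1) = 2 * c - 2" "2 * (c - 1) + 1 = 2 * c - 1" "2 * (c - 1) + 2 = 2 * c"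
        using L(6) by auto
      moreover have "L' ! 2 = L ! 0" using nth[of 0] L(6) by (simp add: numeral_2_eq_2)
      ultimately have "E {L' ! 0, L' ! 1, L' ! 2}" using last by (simp add: L'_def)
      then show ?thesis using 0 by (simp add: numeral_2_eq_2)
    next
      case (Suc j)
      have "E {L ! (2 * j), L ! (2 * j + 1), L ! (2 * j + 2)}"
        using L(1) i len L(5) Suc unfolding lpath_nth by auto
      moreover have "L' ! (2 * i) = L ! (2 * j)" "L' ! (2 * i + 1) = L ! (2 * j + 1)" "L' ! (2 * i + 2) = L ! (2 * j + 2)"
        using nth[of "2 * j"] nth[of "2 * j + 1"] nth[of "2 * j + 2"] i len L(5) Suc by auto
      ultimately show ?thesis by simp
    qed
  qed
  moreover have "hd L' = last L'"
  proof -
    have "L \<noteq> []" using L(5) by auto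
    then show ?thesis using L(5,6) by (simp add: L'_def last_conv_nth numeral_2_eq_2)
  qed
  moreover have "distinct (tl L')"
  proof -
    have "distinct (take (2 * c - 1) L @ [L ! (2 * c - 1)])"
    proof -
      have "take (2 * c - 1) L @ [L ! (2 * c - 1)] = take (Suc (2 * c - 1)) L"
        by (rule take_Suc_conv_app_nth[symmetric]) (use L(5,6) in simp)
      also have "\<dots> = butlast L" using L(5,6) by (simp add: butlast_conv_take)
      finally show ?thesis using L(4) by simp
    qed
    then show ?thesis by (simp add: L'_def)
  qed
  moreover have "set L' \<subseteq> set L"
    using L(5,6) by (auto simp: L'_def dest: in_set_takeD)
  ultimately show ?thesis using len by blast
qed

text \<open>The cycle occupies \<open>2 * c\<close> vertices and leaves \<open>k + 1\<close> for
  \<open>W\<close>. If there is a cycle with \<open>c + 2\<close> edges, unextendability fails, but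
  then \<open>long_cycle\<close> gives the path directly.\<close>

lemma cycle_step:
  assumes V: "finite V" "2 * c + k + 1 \<le> card V" and k: "2 \<le> k" "2 * k \<le> c"
    and cyc: "cycle_in E V c" and no: "\<not> cycle_in E V (c + 1)"
  shows "path_in (\<lambda>e. \<not> E e) V (2 * k)"
proof (cases "cycle_in E V (c + 2)")
  case True
  then show ?thesis using no _ k(2) by (rule long_cycle) (use k in simp)
next
  case no2: False
  obtain L where L: "lpath E L" "hd L = last L" "distinct (tl L)" "length L = 2 * c + 1" "set L \<subseteq> V"
    using cyc by (auto simp: cycle_in_def)
  have "card (set L) \<le> 2 * c"
  proof -
    have "last L \<in> set (tl L)" using L(4) k by (cases L) auto
    then have "set L = set (tl L)" using L(2,4) by (cases L) auto
    then show ?thesis using card_length[of "tl L"] L(4) by simp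
  qed
  then have "k + 1 \<le> card (V - set L)"
    using V L(5) by (subst card_Diff_subset) auto
  then obtain W where W: "W \<subseteq> V - set L" "card W = k + 1"
    using obtain_subset_with_card_n by metis
  have fW: "finite W" using W(1) V(1) by (auto intro: finite_subset)
  have un: "unextendable E M W" if "lpath E M" "hd M = last M" "distinct (tl M)" "length M = 2 * c + 1" "set M \<subseteq> set L" for M
    by (rule cycle_unextendable[OF that(1-4), of V]) (use that L(5) W k no no2 fW in auto)
  interpret U: unextendable E L W by (rule un) (use L in auto)
  have concl: "path_in (\<lambda>e. \<not> E e) V (2 * k)"
    if vs: "\<exists>vs. lpath (\<lambda>e. \<not> E e) vs \<and> distinct vs \<and> length vs = 4 * k + 1 \<and> set vs \<subseteq> (!) M ` {..2 * (2 * k)} \<union> W"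
      and M: "length M = 2 * c + 1" "set M \<subseteq> set L" for M
  proof -
    have "(!) M ` {..2 * (2 * k)} \<subseteq> set M" using M(1) k by auto
    then have "(!) M ` {..2 * (2 * k)} \<union> W \<subseteq> V" using M(2) L(5) W(1) by blast
    then show ?thesis using vs unfolding path_in_def by (auto 4 4)
  qed
  have disj: "(!) M ` {..2 * (2 * k)} \<inter> W = {}" if "length M = 2 * c + 1" "set M \<subseteq> set L" for M
  proof -
    have "(!) M ` {..2 * (2 * k)} \<subseteq> set M" using that(1) k by auto
    then show ?thesis using that(2) W(1) by blast
  qed
  interpret S: segment E "(!) L" W "2 * k"
    using U.segment[of 0 "2 * k"] L(4) k by simp
  have inj1: "inj_on ((!) L) {1..2 * (2 * k)}"
    by (rule inj_on_nth_interval) (use L k in auto)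
  have inj2: "inj_on ((!) L) {..<2 * (2 * k)}"
    by (rule inj_on_subset[OF inj_on_nth_lessThan[OF U.distinct_L(2)]]) (use L(4) k in auto)
  show ?thesis
  \<comment> \<open>Only for \<open>c = 2 * k\<close> do positions \<open>0\<close> and
    \<open>4 * k\<close> carry the same vertex. If edge \<open>0\<close> is right clean or the last
    edge left clean, one of the two positions stays free. Otherwise these edges have to be merged
    across the seam, and the rotated list makes them edges \<open>0\<close> and
    \<open>1\<close>.\<close>
  proof (cases "c = 2 * k \<and> \<not> S.right_clean 0 \<and> \<not> S.left_clean (2 * k - 1)")
    case False
    have "inj_on ((!) L) {..2 * (2 * k)} \<or>
      inj_on ((!) L) {1..2 * (2 * k)} \<and> (S.right_clean 0 \<or> 1 < 2 * k \<and> \<not> S.left_clean 0 \<and> \<not> S.right_clean 1) \<or>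
      inj_on ((!) L) {..<2 * (2 * k)} \<and> S.left_clean (2 * k - 1)"
    proof (cases "c = 2 * k")
      case True
      then show ?thesis using False inj1 inj2 by blast
    next
      case False
      then have "inj_on ((!) L) {..2 * (2 * k)}"
        by (intro inj_on_subset[OF inj_on_nth_lessThan[OF U.distinct_L(2)]]) (use L(4) k in auto)
      then show ?thesis by blast
    qed
    from S.complement_path[OF k(1) refl W(2) disj[OF L(4) subset_refl] this inj2]
    show ?thesis by (rule concl) (use L in auto)
  next
    case True
    then have c: "c = 2 * k" and nr: "\<not> S.right_clean 0" and nl: "\<not> S.left_clean (2 * k - 1)" by auto
    define M where "M = L ! (2 * c - 2) # L ! (2 * c - 1) # take (2 * c - 1) L"
    have M: "lpath E M" "hd M = last M" "distinct (tl M)" "length M = length L" "set M \<subseteq> set L"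
      using rotate_cycle[OF L(1-3) U.distinct_L(2) L(4)] k unfolding M_def by auto
    interpret UM: unextendable E M W by (rule un) (use M L(4) in auto)
    interpret T: segment E "(!) M" W "2 * k"
      using UM.segment[of 0 "2 * k"] M(4) L(4) k by simp
    have last: "L ! (4 * k) = L ! 0"
      using closed_nth[OF L(2,4)] c by simp
    have "\<not> T.left_clean 0"
    proof -
      have "M ! 1 = L ! (2 * (2 * k - 1) + 1)" "M ! 2 = L ! (2 * (2 * k - 1) + 2)"
      proof -
        have e: "2 * (2 * k - 1) + 1 = 2 * c - 1" "2 * (2 * k - 1) + 2 = 4 * k" using k c by auto
        show "M ! 1 = L ! (2 * (2 * k - 1) + 1)" unfolding e by (simp add: M_def)
        have "M ! Suc (Suc 0) = L ! 0" using k c by (simp add: M_def)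
        then show "M ! 2 = L ! (2 * (2 * k - 1) + 2)" unfolding e last by (simp add: numeral_2_eq_2)
      qed
      then show ?thesis using nl unfolding T.left_clean_def S.left_clean_def by (simp add: numeral_2_eq_2)
    qed
    moreover have "\<not> T.right_clean 1"
    proof -
      have "M ! 2 = L ! 0" "M ! 3 = L ! 1"
        using k by (auto simp: M_def c numeral_2_eq_2 numeral_3_eq_3)
      then show ?thesis using nr by (simp add: T.right_clean_def S.right_clean_def numeral_3_eq_3 numeral_2_eq_2)
    qed
    moreover have "inj_on ((!) M) {1..2 * (2 * k)}"
      by (rule inj_on_nth_interval) (use M L(4) k in auto)
    ultimately have "inj_on ((!) M) {..2 * (2 * k)} \<or>
      inj_on ((!) M) {1..2 * (2 * k)} \<and> (T.right_clean 0 \<or> 1 < 2 * k \<and> \<not> T.left_clean 0 \<and> \<not> T.right_clean 1) \<or>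
      inj_on ((!) M) {..<2 * (2 * k)} \<and> T.left_clean (2 * k - 1)" using k by auto
    moreover have "inj_on ((!) M) {..<2 * (2 * k)}"
      by (rule inj_on_subset[OF inj_on_nth_lessThan[OF UM.distinct_L(2)]]) (use L(4) M(4) k in auto)
    moreover have "(!) M ` {..2 * (2 * k)} \<inter> W = {}" using disj M L(4) by simp
    ultimately show ?thesis
      using T.complement_path[OF k(1) refl W(2)] concl[of M] M L(4) by simp
  qed
qed

section \<open>The ends of a longest path, and closing a chain to a cycle\<close>

lemma path_end_edge:
  assumes L: "lpath E L" "distinct L" "length L = 2 * r + 1" "0 < r" "set L \<subseteq> V"
    and no: "\<not> path_in E V (r + 1)" and w: "w \<in> V - set L" "w' \<in> V - set L" "w \<noteq> w'"
    and z: "z \<in> {L ! 0, L ! 1}"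
  shows "\<not> E {z, w, w'}"
proof
  assume e: "E {z, w, w'}"
  obtain a b c xs where abc: "L = a # b # c # xs"
    using L(3,4) by (cases L; cases "tl L"; cases "tl (tl L)") auto
  \<comment> \<open>The first two vertices of a path are interchangeable, so either may become the
    vertex at which the new edge is attached.\<close>
  obtain a' b' where ab: "z = a'" "{a', b'} = {a, b}" "a' \<noteq> b'"
    using z L(2) by (auto simp: abc)
  let ?M = "w' # w # a' # b' # c # xs"
  have "{a', b', c} = {a, b, c}" using ab(2) by blast
  then have "lpath E ?M" using e L(1) ab(1) by (simp add: abc insert_commute)
  moreover have "set ?M \<subseteq> V"
  proof -
    have "set ?M = insert w (insert w' (set L))" using ab(2) by (auto simp: abc)
    then show ?thesis using w L(5) by simp
  qed
  moreover have "distinct ?M" using L(2) w ab(2,3) by (auto simp: abc doubleton_eq_iff)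
  moreover have "length ?M = 2 * (r + 1) + 1" using L(3) by (simp add: abc)
  ultimately show False using no unfolding path_in_def by blast
qed

text \<open>A Posa rotation at the first vertex: the part of the path before the \<open>i\<close>-th edge is reversed.\<close>

lemma path_end_rotate:
  assumes L: "lpath E L" "distinct L" "length L = 2 * r + 1" "set L \<subseteq> V"
    and no: "\<not> path_in E V (r + 1)" and W: "W \<subseteq> V - set L" and i: "i < r"
  shows "2 \<le> card (bad E W (L ! (2 * i + 1)) (L ! (2 * i + 2))) \<Longrightarrow>
      bad E W (L ! 0) (L ! (2 * i + 1)) = {}"
    and "2 \<le> card (bad E W (L ! (2 * i)) (L ! (2 * i + 1))) \<Longrightarrow>
      bad E W (L ! 0) (L ! (2 * i + 2)) = {}"
proof -
  define A b B where "A = take (2 * i) L" and "b = L ! (2 * i + 1)" and "B = drop (2 * i + 3) L"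
  define a c where "a = L ! (2 * i)" and "c = L ! (2 * i + 2)"
  have L_eq: "L = A @ a # b # c # B"
    using i L(3) by (simp add: A_def B_def a_def b_def c_def Cons_nth_drop_Suc numeral_3_eq_3)
  have ev: "even (length A)" using i L(3) by (simp add: A_def)
  have lA: "lpath E (A @ [a])" and lB: "lpath E (a # b # c # B)"
    using lpath_appendD[OF L(1)[unfolded L_eq] ev] .
  then have lB': "lpath E (c # B)" by simp
  obtain h T where hT: "A @ [a] = h # T" "L ! 0 = h"
  proof (cases A)
    case Nil
    then show ?thesis using that[of a "[]"] by (simp add: L_eq)
  next
    case (Cons x xs)
    then show ?thesis using that[of x "xs @ [a]"] by (simp add: L_eq)
  qed
  have evT: "even (length (rev T))" using ev arg_cong[OF hT(1), of length] by simp
  have lA': "lpath E (rev T @ [h])" using lA lpath_rev[of E "A @ [a]"] hT(1) by simp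
  have dL: "distinct (A @ a # b # c # B)" using L(2) L_eq by simp
  have rT: "rev T @ [h] = a # rev A" using arg_cong[OF hT(1), of rev] by simp
  have sT: "insert h (set T) = insert a (set A)" using arg_cong[OF hT(1), of set] by auto
  have dT: "distinct (rev T @ [h])" unfolding rT using dL by auto
  have lenT: "length T = length A" using arg_cong[OF hT(1), of length] by simp
  \<comment> \<open>In both cases edge \<open>a, b, c\<close> is given up and two edges are gained.
    The new path is either the reversed front, \<open>z, b, y, c\<close> and the rest, or
    \<open>b, y\<close>, the reversed front, \<open>z, c\<close> and the rest.\<close>
  have False if y: "y \<in> W" "z \<in> W" "y \<noteq> z" and e: "E {h, b, z} \<and> E {b, c, y} \<or> E {h, c, z} \<and> E {a, b, y}" for y z
  proof -
    have yz: "y \<notin> set L" "z \<notin> set L" "y \<in> V" "z \<in> V" using y W by auto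
    have "\<exists>M. lpath E M \<and> distinct M \<and> length M = length L + 2 \<and> set M \<subseteq> insert y (insert z (set L))"
      using e
    proof
      assume e: "E {h, b, z} \<and> E {b, c, y}"
      let ?M = "rev T @ h # [z, b, y, c] @ B"
      have "lpath E ?M"
        using lpath_append[OF evT, of E h "[z, b, y, c] @ B"] lA' lB' e by (simp add: insert_commute)
      moreover have "distinct ?M" using dT dL yz y(3) sT unfolding L_eq by auto
      moreover have "length ?M = length L + 2" using lenT by (simp add: L_eq)
      moreover have "set ?M \<subseteq> insert y (insert z (set L))" using sT unfolding L_eq by auto
      ultimately show ?thesis by blast
    next
      assume e: "E {h, c, z} \<and> E {a, b, y}"
      let ?M = "b # y # rev T @ h # [z, c] @ B"
      have "lpath E (rev T @ h # [z, c] @ B)"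
        using lpath_append[OF evT, of E h "[z, c] @ B"] lA' lB' e by (simp add: insert_commute)
      moreover have eq: "rev T @ h # [z, c] @ B = a # rev A @ [z, c] @ B"
        using arg_cong[OF rT, of "\<lambda>xs. xs @ [z, c] @ B"] by simp
      ultimately have "lpath E (a # rev A @ [z, c] @ B)" by (simp only:)
      then have "lpath E ?M" unfolding eq using e by (simp add: insert_commute)
      moreover have "distinct ?M" using dT dL yz y(3) sT unfolding L_eq by auto
      moreover have "length ?M = length L + 2" using lenT by (simp add: L_eq)
      moreover have "set ?M \<subseteq> insert y (insert z (set L))" using sT unfolding L_eq by auto
      ultimately show ?thesis by blast
    qed
    then obtain M where "lpath E M" "distinct M" "length M = length L + 2" "set M \<subseteq> insert y (insert z (set L))" by blast
    moreover from this have "length M = 2 * (r + 1) + 1" "set M \<subseteq> V" using L(3,4) yz by auto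
    ultimately show False using no unfolding path_in_def by blast
  qed
  note F = this
  show "bad E W (L ! 0) (L ! (2 * i + 1)) = {}" if card: "2 \<le> card (bad E W (L ! (2 * i + 1)) (L ! (2 * i + 2)))"
  proof (rule ccontr)
    assume "bad E W (L ! 0) (L ! (2 * i + 1)) \<noteq> {}"
    then obtain z where z: "z \<in> bad E W h b" using hT(2) b_def by blast
    obtain y where "y \<in> bad E W b c" "y \<notin> {z}"
      using ex_not_in[of "{z}" "bad E W b c"] card by (auto simp: b_def c_def)
    then show False using F[of y z] z by (auto simp: bad_def)
  qed
  show "bad E W (L ! 0) (L ! (2 * i + 2)) = {}" if card: "2 \<le> card (bad E W (L ! (2 * i)) (L ! (2 * i + 1)))"
  proof (rule ccontr)
    assume "bad E W (L ! 0) (L ! (2 * i + 2)) \<noteq> {}"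
    then obtain z where z: "z \<in> bad E W h c" using hT(2) c_def by blast
    obtain y where "y \<in> bad E W a b" "y \<notin> {z}"
      using ex_not_in[of "{z}" "bad E W a b"] card by (auto simp: a_def b_def)
    then show False using F[of y z] z by (auto simp: bad_def)
  qed
qed

lemma cycle_inI:
  assumes "lpath E xs" "lpath E (last xs # cs @ [hd xs])" "distinct (xs @ cs)"
    "length xs + length cs = 2 * n" "set (xs @ cs) \<subseteq> V"
  shows "cycle_in E V n"
proof -
  have odd: "odd (length xs)" using assms(1) by (rule lpath_odd)
  obtain ys y where ys: "xs = ys @ [y]" using odd by (cases xs rule: rev_cases) auto
  obtain z zs where z: "xs = z # zs" using odd by (cases xs) auto
  let ?vs = "xs @ cs @ [z]"
  have "hd xs = z" using z by simp
  moreover have "last xs = y" using ys by simp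
  ultimately have "lpath E (y # cs @ [z])" using assms(2) by simp
  moreover have "even (length ys)" "lpath E (ys @ [y])" using odd assms(1) ys by auto
  ultimately have "lpath E (ys @ y # cs @ [z])" using lpath_append[of ys E y "cs @ [z]"] by blast
  then have "lpath E ?vs" by (simp add: ys)
  moreover have "hd ?vs = last ?vs" by (simp add: z)
  moreover have "distinct (tl ?vs)" using assms(3) by (auto simp: z)
  moreover have "length ?vs = 2 * n + 1" "set ?vs \<subseteq> V" using assms(4,5) by (auto simp: z)
  ultimately show ?thesis unfolding cycle_in_def by blast
qed

text \<open>The path leaves \<open>k + 2\<close> vertices for \<open>W\<close>. After the first
  edge, \<open>2 * k - 4\<close> edges are used as a segment and replaced by as many edges of the
  other colour. The four outer vertices of the two end edges of the path, each placed between two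
  vertices of \<open>W\<close> or absorbed into a configuration, account for the missing
  four.\<close>

lemma path_step:
  assumes V: "finite V" "2 * r + k + 3 \<le> card V" and k: "2 \<le> k" "2 * k - 2 \<le> r"
    and path: "path_in E V r" and no: "\<not> path_in E V (r + 1)"
  shows "cycle_in (\<lambda>e. \<not> E e) V (2 * k)"
proof -
  obtain L where L: "lpath E L" "distinct L" "length L = 2 * r + 1" "set L \<subseteq> V"
    using path by (auto simp: path_in_def)
  define t where "t = k - 2"
  have k_eq: "k = t + 2" using k by (simp add: t_def)
  have r: "2 * t + 2 \<le> r" using k by (simp add: t_def)
  have "k + 2 \<le> card (V - set L)"
    using V L by (subst card_Diff_subset) (auto simp: distinct_card)
  then obtain W where W': "W \<subseteq> V - set L" "card W = k + 2"
    using obtain_subset_with_card_n by metis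
  then have W: "W \<subseteq> V - set L" "card W = t + 4" using k_eq by simp_all
  have fW: "finite W" using W(1) V(1) by (auto intro: finite_subset)
  interpret U: unextendable E L W by (rule path_unextendable[OF L no W(1) fW])
  \<comment> \<open>The shift by two positions skips the first edge; together with
    \<open>2 * t + 2 \<le> r\<close> it keeps the four outer end vertices out of the
    segment.\<close>
  define v where "v = (\<lambda>x. L ! (2 + x))"
  interpret S: segment E v W "2 * t"
    using U.segment[of 1 "2 * t"] L(3) r by (simp add: v_def)
  have vL: "v ` {..4 * t} \<subseteq> set L"
    using L(3) r by (auto simp: v_def)
  have inj: "inj_on v {..2 * (2 * t)}"
    using L(2,3) r by (auto simp: inj_on_def v_def nth_eq_iff_index_eq)
  have rev_nth: "rev L ! x = L ! (2 * r - x)" if "x \<le> 2 * r" for x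
    using that L(3) by (simp add: rev_nth)
  have revL: "lpath E (rev L)" "distinct (rev L)" "length (rev L) = 2 * r + 1" "set (rev L) \<subseteq> V" "W \<subseteq> V - set (rev L)"
    using L W by (auto simp: lpath_rev)
  let ?ends = "[L ! 0, L ! 1, L ! (2 * r - 1), L ! (2 * r)]"
  have ends_dist: "distinct ?ends"
    using L(2,3) r by (auto simp: nth_eq_iff_index_eq)
  have ends_L: "set ?ends \<subseteq> set L" using L(3) r by auto
  have ends_v: "set ?ends \<inter> v ` {..4 * t} = {}"
    using L(2,3) r by (auto simp: v_def nth_eq_iff_index_eq)
  have end_edge: "\<not> E {w, z, w'}" if "z \<in> set ?ends" "w \<in> W" "w' \<in> W" "w \<noteq> w'" for z w w'
  proof -
    have "z \<in> {L ! 0, L ! 1} \<or> z \<in> {rev L ! 0, rev L ! 1}"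
      using that(1) r rev_nth[of 0] rev_nth[of 1] by auto
    moreover have "w \<in> V - set L" "w' \<in> V - set L" "w \<in> V - set (rev L)" "w' \<in> V - set (rev L)"
      using that W(1) by auto
    moreover have "0 < r" using r by simp
    ultimately have "\<not> E {z, w, w'}"
      using path_end_edge[OF L(1-3) _ L(4) no _ _ that(4)] path_end_edge[OF revL(1-3) _ revL(4) no _ _ that(4)]
      by blast
    then show ?thesis by (simp add: insert_commute)
  qed
  \<comment> \<open>Whichever kind edge \<open>i\<close> has, the first end fits to the second
    vertex of its clean pair, and by reversal the last end to the first vertex.\<close>
  have rot: "bad E W (L ! 0) (v (S.clean_pair i ! 1)) = {}" "bad E W (L ! (2 * r)) (v (S.clean_pair i ! 0)) = {}"
    if i: "i < 2 * t" "S.left_clean i \<or> S.right_clean i" for i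
  proof -
    let ?i = "r - 2 - i"
    have x: "2 * ?i \<le> 2 * r" "2 * ?i + 1 \<le> 2 * r" "2 * ?i + 2 \<le> 2 * r"
      "2 * r - 2 * ?i = 2 * i + 4" "2 * r - (2 * ?i + 1) = 2 * i + 3" "2 * r - (2 * ?i + 2) = 2 * i + 2"
      using i(1) r by auto
    have R: "rev L ! (2 * ?i) = L ! (2 * i + 4)" "rev L ! (2 * ?i + 1) = L ! (2 * i + 3)" "rev L ! (2 * ?i + 2) = L ! (2 * i + 2)"
      "rev L ! 0 = L ! (2 * r)"
      using rev_nth[OF x(1)] rev_nth[OF x(2)] rev_nth[OF x(3)] rev_nth[of 0] unfolding x by auto
    have ir: "i + 1 < r" "?i < r" using i(1) r by auto
    have e: "2 * (i + 1) = 2 * i + 2" "2 * i + 2 + 1 = 2 * i + 3" "2 * i + 2 + 2 = 2 * i + 4" by auto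
    note A = path_end_rotate[OF L no W(1) ir(1), unfolded e]
    note B = path_end_rotate[OF revL(1-4) no revL(5) ir(2), unfolded R]
    have v: "v (2 * i) = L ! (2 * i + 2)" "v (2 * i + 1) = L ! (2 * i + 3)" "v (2 * i + 2) = L ! (2 * i + 4)"
      by (simp_all add: v_def eval_nat_numeral)
    show "bad E W (L ! 0) (v (S.clean_pair i ! 1)) = {}"
    proof (cases "S.left_clean i")
      case True
      then show ?thesis using A(1) v by (simp add: S.clean_pair_def S.left_clean_def)
    next
      case False
      then have "S.right_clean i" using i by blast
      then show ?thesis using A(2) v False by (simp add: S.clean_pair_def S.right_clean_def)
    qed
    show "bad E W (L ! (2 * r)) (v (S.clean_pair i ! 0)) = {}"
    proof (cases "S.left_clean i")
      case True
      then show ?thesis using B(2) v by (simp add: S.clean_pair_def S.left_clean_def bad_commute)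
    next
      case False
      then have "S.right_clean i" using i by blast
      then show ?thesis using B(1) v False by (simp add: S.clean_pair_def S.right_clean_def bad_commute)
    qed
  qed
  obtain Ms Ds P where dist: "distinct (concat (Ms @ Ds))"
    and small: "\<And>C. C \<in> set (Ms @ Ds) \<Longrightarrow> small E W C"
    and P: "finite P" "\<And>i. i \<in> P \<Longrightarrow> i < 2 * t \<and> (S.left_clean i \<or> S.right_clean i)"
      "\<And>i j. i \<in> P \<Longrightarrow> j \<in> P \<Longrightarrow> i \<noteq> j \<Longrightarrow> set (S.clean_pair i) \<inter> set (S.clean_pair j) = {}"
      "inj_on v (\<Union>i\<in>P. set (S.clean_pair i))"
    and CP: "set (concat (Ms @ Ds)) \<inter> v ` (\<Union>i\<in>P. set (S.clean_pair i)) = {}"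
    and sub: "set (concat (Ms @ Ds)) \<subseteq> v ` {..2 * (2 * t)}"
    and count: "2 * length Ms + length Ds + card P = 2 * t"
    and "\<And>i. i < 2 * t \<Longrightarrow> i \<in> P \<or> (\<exists>C\<in>set (Ms @ Ds).
      {bad E W (v (2 * i)) (v (2 * i + 1)), bad E W (v (2 * i + 1)) (v (2 * i + 2))} \<inter>
      {side1 E W C, side2 E W C} \<noteq> {})"
    using S.decomposition[OF disjI1[OF inj]] by blast
  have close: "cycle_in (\<lambda>e. \<not> E e) V (2 * k)"
    if Cs: "\<And>C. C \<in> set Cs \<Longrightarrow> length C = 3" and xs: "list_all2 (\<lambda>x B. x \<in> W \<and> x \<notin> B) xs (forbidden E W {} Cs {})"
      and cs: "\<And>x y. x \<in> set xs \<Longrightarrow> y \<in> set xs \<Longrightarrow> lpath (\<lambda>e. \<not> E e) (x # cs @ [y])"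
      and d: "distinct (xs @ cs @ concat Cs)"
      and len: "4 * length Cs + 1 + length cs = 4 * k" and V': "set (cs @ concat Cs) \<subseteq> V" for Cs xs cs
  proof (rule cycle_inI[where xs = "weave xs Cs" and cs = cs])
    have l: "length xs = Suc (length Cs)" using list_all2_lengthD[OF xs] by simp
    then have ne: "xs \<noteq> []" by auto
    show "lpath (\<lambda>e. \<not> E e) (weave xs Cs)" using lpath_weave[OF xs Cs] by blast
    show "lpath (\<lambda>e. \<not> E e) (last (weave xs Cs) # cs @ [hd (weave xs Cs)])"
      unfolding last_weave[OF l] hd_weave[OF ne] using ne by (intro cs) auto
    show "distinct (weave xs Cs @ cs)"
      using d distinct_weave[OF l] set_weave[OF l] by auto
    show "length (weave xs Cs) + length cs = 2 * (2 * k)"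
      using length_weave[OF l Cs] len by simp
    show "set (weave xs Cs @ cs) \<subseteq> V"
      using V' set_weave[OF l] list_all2_subset[OF xs] W(1) by auto
  qed
  have sub': "set (concat (Ms @ Ds)) \<subseteq> v ` {..4 * t}" using sub by simp
  have WV: "W \<subseteq> V" "W \<inter> set L = {}" using W(1) by auto
  show ?thesis
  proof (cases "2 \<le> card P")
    case False
    define Cs where "Cs = take t (Ms @ Ds)"
    have len: "length Cs = t"
      using count False by (auto simp: Cs_def min_def)
    have sC: "set (concat Cs) \<subseteq> v ` {..4 * t}"
      using set_concat_take sub' unfolding Cs_def by (rule subset_trans)
    have smallC: "small E W C" if "C \<in> set Cs" for C
      using that small unfolding Cs_def by (blast dest: in_set_takeD)
    \<comment> \<open>The three empty sets are for \<open>z1, z2, z3\<close>, the vertices between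
      the four end vertices. Standing in front they are chosen last, and all \<open>t + 4\<close>
      vertices of \<open>W\<close> get used.\<close>
    let ?Bs = "[{}, {}, {}] @ forbidden E W {} (Cs @ []) {}"
    have c2: "card B \<le> 2" if "B \<in> set (forbidden E W {} (Cs @ []) {})" for B
      by (rule card_forbidden[OF smallC _ _ _ _ that]) auto
    have "\<exists>xs. distinct xs \<and> list_all2 (\<lambda>x B. x \<in> W \<and> x \<notin> B) xs ?Bs"
    proof (rule distinct_representatives[OF fW])
      show "finite B" if "B \<in> set ?Bs" for B
        using that finite_forbidden[OF fW, of "{}" "{}" B E "Cs @ []"] by (auto simp del: append_Nil2)
      fix i assume i: "i < length ?Bs"
      show "card (?Bs ! i) + (length ?Bs - Suc i) < card W"
      proof (cases "i < 3")
        case True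
        then have "i = 0 \<or> i = 1 \<or> i = 2" by auto
        then show ?thesis using W(2) len by auto
      next
        case False
        then have "?Bs ! i = forbidden E W {} (Cs @ []) {} ! (i - 3)" "i - 3 < length (forbidden E W {} (Cs @ []) {})"
          using i by (simp_all add: nth_append numeral_3_eq_3)
        then have "card (?Bs ! i) \<le> 2" using c2[of "?Bs ! i"] by simp
        then show ?thesis using W(2) len i False by simp
      qed
    qed
    then obtain zs where zs: "distinct zs" "list_all2 (\<lambda>x B. x \<in> W \<and> x \<notin> B) zs ?Bs" by blast
    then obtain z1 z2 z3 xs where z: "zs = z1 # z2 # z3 # xs" "z1 \<in> W" "z2 \<in> W" "z3 \<in> W"
      and xs: "list_all2 (\<lambda>x B. x \<in> W \<and> x \<notin> B) xs (forbidden E W {} Cs {})"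
      by (auto simp: list_all2_Cons2)
    have xsW: "set xs \<subseteq> W" by (rule list_all2_subset[OF xs])
    let ?cs = "[L ! 0, z1, L ! 1, z2, L ! (2 * r - 1), z3, L ! (2 * r)]"
    show ?thesis
    proof (rule close[OF _ xs, where cs = ?cs])
      show "length C = 3" if "C \<in> set Cs" for C using smallC[OF that] by (simp add: small_def)
      show "lpath (\<lambda>e. \<not> E e) (x # ?cs @ [y])" if "x \<in> set xs" "y \<in> set xs" for x y
      proof -
        have "x \<in> W" "y \<in> W" "x \<noteq> z1" "z3 \<noteq> y" "z1 \<noteq> z2" "z2 \<noteq> z3"
          using that xsW zs(1) by (auto simp: z(1))
        then show ?thesis
          using end_edge[of "L ! 0" x z1] end_edge[of "L ! 1" z1 z2] end_edge[of "L ! (2 * r - 1)" z2 z3]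
            end_edge[of "L ! (2 * r)" z3 y] z(2-4) by simp
      qed
      have 1: "distinct (z1 # z2 # z3 # xs)" "set (z1 # z2 # z3 # xs) \<subseteq> W" using zs(1) z xsW by auto
      have 2: "distinct (?ends @ concat Cs)"
        using ends_dist ends_v sC distinct_concat_take[OF dist] unfolding distinct_append Cs_def by blast
      have 3: "set (?ends @ concat Cs) \<subseteq> set L" using ends_L sC vL by auto
      have "distinct ((z1 # z2 # z3 # xs) @ (?ends @ concat Cs))"
        unfolding distinct_append[of "z1 # z2 # z3 # xs"] using 1 2 3 WV(2) by blast
      then show "distinct (xs @ ?cs @ concat Cs)" by auto
      show "4 * length Cs + 1 + length ?cs = 4 * k" using len k_eq by simp
      show "set (?cs @ concat Cs) \<subseteq> V"
        using 3 L(4) WV(1) z by auto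
    qed
  next
    case True
    obtain e f Js where J: "e \<in> P" "f \<in> P" "e \<noteq> f" "length Js = (card P - 2) div 2"
      "\<forall>C\<in>set Js. joint E W (map v C)" "distinct (concat Js)"
      "set (concat Js) \<subseteq> (\<Union>i\<in>P - {e, f}. set (S.clean_pair i))"
      using S.joins[OF P(1) True P(2,3)] by blast
    have pr_eq: "S.clean_pair i = [S.clean_pair i ! 0, S.clean_pair i ! 1]" for i by (simp add: S.clean_pair_def)
    have pr_dist: "distinct (S.clean_pair i)" for i by (simp add: S.clean_pair_def)
    have pr_sub: "set (S.clean_pair i) \<subseteq> {..4 * t}" if "i \<in> P" for i
      using P(2)[OF that] by (auto simp: S.clean_pair_def)
    define Ss' where "Ss' = take (t - 1) (Ms @ Ds)"
    define Js' where "Js' = take (t - 1 - length Ss') Js"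
    have t0: "0 < t" using count True by linarith
    have len: "length Ss' + length Js' = t - 1"
      using count True J(4) by (auto simp: Ss'_def Js'_def min_def)
    have pos: "distinct (S.clean_pair e @ S.clean_pair f @ concat Js')"
      "set (S.clean_pair e @ S.clean_pair f @ concat Js') \<subseteq> (\<Union>i\<in>P. set (S.clean_pair i))"
    proof -
      have s: "set (concat Js') \<subseteq> (\<Union>i\<in>P - {e, f}. set (S.clean_pair i))"
        using J(7) set_concat_take[of _ Js] unfolding Js'_def by blast
      then show "set (S.clean_pair e @ S.clean_pair f @ concat Js') \<subseteq> (\<Union>i\<in>P. set (S.clean_pair i))"
        using J(1,2) by auto
      have "set (S.clean_pair e) \<inter> set (concat Js') = {}" "set (S.clean_pair f) \<inter> set (concat Js') = {}"
        using s P(3) J(1,2) by blast+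
      then show "distinct (S.clean_pair e @ S.clean_pair f @ concat Js')"
        using pr_dist P(3)[OF J(1-3)] distinct_concat_take[OF J(6)] unfolding Js'_def by auto
    qed
    let ?Js = "map (map v) Js'"
    let ?p = "[v (S.clean_pair e ! 0), v (S.clean_pair e ! 1), v (S.clean_pair f ! 0), v (S.clean_pair f ! 1)]"
    have a: "distinct (map v (S.clean_pair e @ S.clean_pair f @ concat Js'))"
      using pos inj_on_subset[OF P(4)] by (simp only: distinct_map)
    have b: "map v (S.clean_pair e @ S.clean_pair f @ concat Js') = ?p @ concat ?Js"
      by (subst pr_eq[of e], subst pr_eq[of f]) (simp add: map_concat)
    have c: "set (map v (S.clean_pair e @ S.clean_pair f @ concat Js')) \<subseteq> v ` (\<Union>i\<in>P. set (S.clean_pair i))"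
      using pos(2) by (simp only: set_map image_mono)
    note pos' = a[unfolded b] c[unfolded b]
    have sS: "set (concat Ss') \<subseteq> set (concat (Ms @ Ds))"
      unfolding Ss'_def by (rule set_concat_take)
    have dS: "distinct (concat Ss')" unfolding Ss'_def using dist by (rule distinct_concat_take)
    have PU: "v ` (\<Union>i\<in>P. set (S.clean_pair i)) \<subseteq> v ` {..4 * t}" using pr_sub by (intro image_mono) blast
    have all: "set (?p @ concat (Ss' @ ?Js)) \<subseteq> v ` {..4 * t}"
      using pos'(2) sS sub' PU unfolding concat_append set_append by blast
    have alld: "distinct (?p @ concat (Ss' @ ?Js))"
      using pos' dS sS CP unfolding concat_append distinct_append set_append by blast
    have small': "small E W C" if "C \<in> set Ss'" for C
      using that small unfolding Ss'_def by (blast dest: in_set_takeD)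
    have joint': "joint E W C" if "C \<in> set ?Js" for C
      using that J(5) unfolding Js'_def by (auto dest: in_set_takeD)
    \<comment> \<open>By \<open>rot\<close>, a clean pair followed by a path end gives a
      configuration with both sides empty. So \<open>L ! 0\<close> and \<open>L ! (2 * r)\<close>
      enter the chain, and only \<open>L ! 1\<close> and \<open>L ! (2 * r - 1)\<close> are left for
      closing it.\<close>
    define K1 where "K1 = [v (S.clean_pair e ! 0), v (S.clean_pair e ! 1), L ! 0]"
    define K2 where "K2 = [v (S.clean_pair f ! 1), v (S.clean_pair f ! 0), L ! (2 * r)]"
    have K: "side1 E W K1 = {}" "side2 E W K1 = {}" "side1 E W K2 = {}" "side2 E W K2 = {}"
      using S.bad_clean_pair[of e] S.bad_clean_pair[of f] P(2)[OF J(1)] P(2)[OF J(2)] rot(1)[of e] rot(2)[of f]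
      by (auto simp: K1_def K2_def side1_def side2_def bad_commute)
    let ?Cs = "K1 # K2 # Ss' @ ?Js"
    let ?F = "forbidden E W {} (Ss' @ ?Js) {}"
    have fC: "forbidden E W {} ?Cs {} = {} # {} # ?F" by (simp add: K)
    let ?Bs = "{} # {} # {} # ?F"
    have c2: "card B \<le> 2" if "B \<in> set ?F" for B
      by (rule card_forbidden[OF small' joint' _ _ _ that]) auto
    have "\<exists>xs. distinct xs \<and> list_all2 (\<lambda>x B. x \<in> W \<and> x \<notin> B) xs ?Bs"
    proof (rule distinct_representatives[OF fW])
      show "finite B" if "B \<in> set ?Bs" for B
        using that finite_forbidden[OF fW, of "{}" "{}" B E "Ss' @ ?Js"] by auto
      fix i assume i: "i < length ?Bs"
      show "card (?Bs ! i) + (length ?Bs - Suc i) < card W"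
      proof (cases "i < 3")
        case True
        then have "i = 0 \<or> i = 1 \<or> i = 2" by auto
        then show ?thesis using W(2) len by auto
      next
        case False
        then have "i = Suc (Suc (Suc (i - 3)))" by linarith
        then obtain j where j: "i = Suc (Suc (Suc j))" by blast
        then have "card (?Bs ! i) \<le> 2" using c2[of "?F ! j"] i by simp
        then show ?thesis using W(2) len i j t0 by simp
      qed
    qed
    then obtain zs where zs: "distinct zs" "list_all2 (\<lambda>x B. x \<in> W \<and> x \<notin> B) zs ?Bs" by blast
    then obtain z xs where z: "zs = z # xs" "z \<in> W"
      and xs: "list_all2 (\<lambda>x B. x \<in> W \<and> x \<notin> B) xs (forbidden E W {} ?Cs {})"
      unfolding fC by (auto simp: list_all2_Cons2)
    have xsW: "set xs \<subseteq> W" by (rule list_all2_subset[OF xs])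
    let ?cs = "[L ! 1, z, L ! (2 * r - 1)]"
    show ?thesis
    proof (rule close[OF _ xs, where cs = ?cs])
      show "length C = 3" if "C \<in> set ?Cs" for C
        using that small'[of C] joint'[of C] by (auto simp: small_def joint_def K1_def K2_def)
      show "lpath (\<lambda>e. \<not> E e) (x # ?cs @ [y])" if "x \<in> set xs" "y \<in> set xs" for x y
      proof -
        have "x \<in> W" "y \<in> W" "x \<noteq> z" "z \<noteq> y"
          using that xsW zs(1) by (auto simp: z(1))
        then show ?thesis
          using end_edge[of "L ! 1" x z] end_edge[of "L ! (2 * r - 1)" z y] z(2) by simp
      qed
      have 1: "distinct (z # xs)" "set (z # xs) \<subseteq> W" using zs(1) z xsW by auto
      have 2: "distinct (?ends @ ?p @ concat (Ss' @ ?Js))"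
        using ends_dist ends_v all alld unfolding distinct_append[of ?ends] by blast
      have 3: "set (?ends @ ?p @ concat (Ss' @ ?Js)) \<subseteq> set L" using ends_L all vL unfolding set_append by blast
      have "distinct ((z # xs) @ (?ends @ ?p @ concat (Ss' @ ?Js)))"
        unfolding distinct_append[of "z # xs"] using 1 2 3 WV(2) by blast
      then show "distinct (xs @ ?cs @ concat ?Cs)"
        by (auto simp: K1_def K2_def)
      show "4 * length ?Cs + 1 + length ?cs = 4 * k" using len k_eq t0 by simp
      show "set (?cs @ concat ?Cs) \<subseteq> V"
      proof -
        have "set (?cs @ concat ?Cs) \<subseteq> insert z (set (?ends @ ?p @ concat (Ss' @ ?Js)))"
          by (auto simp: K1_def K2_def)
        then show ?thesis using 3 L(4) WV(1) z by blast
      qed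
    qed
  qed
qed

section \<open>The Ramsey number\<close>

text \<open>If some triple \<open>a, b, c\<close> has the path's colour, every triple meeting it in
  exactly one vertex has the other colour; if there is none, all triples do. Either way five further
  vertices close a cycle in which every edge contains exactly one of \<open>a, b, c\<close>. It
  starts the induction at \<open>m = 3\<close>, where paths of length two are needed.\<close>

lemma path_two_or_cycle_four:
  assumes V: "8 \<le> card V" and no: "\<not> path_in (\<lambda>e. \<not> E e) V 2"
  shows "cycle_in E V 4"
proof -
  have "\<exists>a b c. {a, b, c} \<subseteq> V \<and> distinct [a, b, c] \<and>
    (\<forall>x\<in>{a, b, c}. \<forall>w\<in>V - {a, b, c}. \<forall>w'\<in>V - {a, b, c}. w \<noteq> w' \<longrightarrow> E {x, w, w'})"
  proof (cases "\<exists>a b c. {a, b, c} \<subseteq> V \<and> distinct [a, b, c] \<and> \<not> E {a, b, c}")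
    case True
    then obtain a b c where abc: "{a, b, c} \<subseteq> V" "distinct [a, b, c]" "\<not> E {a, b, c}" by blast
    have "E {x, w, w'}" if x: "x \<in> {a, b, c}" and w: "w \<in> V - {a, b, c}" "w' \<in> V - {a, b, c}" "w \<noteq> w'" for x w w'
    proof (rule ccontr)
      assume e: "\<not> E {x, w, w'}"
      obtain y z where yz: "{x, y, z} = {a, b, c}" "distinct [x, y, z]"
        using x abc(2) by (auto simp: insert_commute)
      have "lpath (\<lambda>e. \<not> E e) [y, z, x, w, w'] \<and> distinct [y, z, x, w, w'] \<and> set [y, z, x, w, w'] \<subseteq> V"
        using yz e abc(1,3) w by (auto simp: insert_commute)
      moreover have "length [y, z, x, w, w'] = 2 * 2 + 1" by simp
      ultimately show False using no unfolding path_in_def by blast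
    qed
    then have "\<forall>x\<in>{a, b, c}. \<forall>w\<in>V - {a, b, c}. \<forall>w'\<in>V - {a, b, c}. w \<noteq> w' \<longrightarrow> E {x, w, w'}"
      by (intro ballI impI)
    with abc(1,2) show ?thesis by (intro exI[of _ a] exI[of _ b] exI[of _ c] conjI)
  next
    case False
    have "3 \<le> card V" using V by simp
    then obtain T where "T \<subseteq> V" "card T = 3" using obtain_subset_with_card_n by metis
    then obtain a b c where abc: "{a, b, c} \<subseteq> V" "distinct [a, b, c]" by (auto simp: card_3_iff)
    have "E {x, w, w'}" if "x \<in> {a, b, c}" "w \<in> V - {a, b, c}" "w' \<in> V - {a, b, c}" "w \<noteq> w'" for x w w'
    proof -
      have "{x, w, w'} \<subseteq> V" "distinct [x, w, w']" using that abc(1) by auto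
      then show ?thesis using False by blast
    qed
    then have "\<forall>x\<in>{a, b, c}. \<forall>w\<in>V - {a, b, c}. \<forall>w'\<in>V - {a, b, c}. w \<noteq> w' \<longrightarrow> E {x, w, w'}"
      by (intro ballI impI)
    with abc show ?thesis by (intro exI[of _ a] exI[of _ b] exI[of _ c] conjI)
  qed
  then obtain a b c where abc: "{a, b, c} \<subseteq> V" "distinct [a, b, c]"
    and E: "\<forall>x\<in>{a, b, c}. \<forall>w\<in>V - {a, b, c}. \<forall>w'\<in>V - {a, b, c}. w \<noteq> w' \<longrightarrow> E {x, w, w'}"
    by (elim exE conjE)
  have "card {a, b, c} = 3" using abc(2) by auto
  then have "5 \<le> card (V - {a, b, c})"
    using V abc(1) by (subst card_Diff_subset) auto
  then obtain T where T: "T \<subseteq> V - {a, b, c}" "card T = 5" "finite T"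
    using obtain_subset_with_card_n by metis
  obtain ws where ws: "set ws = T" "distinct ws"
    using finite_distinct_list[OF T(3)] by blast
  then have "length ws = 5" using T(2) distinct_card by fastforce
  then obtain w1 w2 w3 w4 w5 where w: "ws = [w1, w2, w3, w4, w5]"
    by (auto simp: eval_nat_numeral length_Suc_conv)
  have wV: "{w1, w2, w3, w4, w5} \<subseteq> V - {a, b, c}" "distinct [w1, w2, w3, w4, w5]"
    using ws T(1) by (auto simp: w)
  let ?vs = "[w1, w2, a, w3, w4, b, w5, c, w1]"
  have "lpath E ?vs"
  proof -
    have "E {a, w1, w2}" "E {a, w3, w4}" "E {b, w4, w5}" "E {c, w1, w5}"
      using E wV by simp_all
    then show ?thesis by (simp add: insert_commute)
  qed
  moreover have "distinct (tl ?vs)" "set ?vs \<subseteq> V" using wV abc by auto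
  ultimately show ?thesis unfolding cycle_in_def by (intro exI[of _ ?vs]) simp
qed

text \<open>Induction on \<open>m\<close>, and for fixed \<open>m\<close> on \<open>n\<close>. For
  \<open>n > m + 1\<close> the inner induction provides the cycle of length \<open>n - 1\<close>
  that \<open>cycle_step\<close> needs; for \<open>n = m + 1\<close> it is out of reach, and the
  case \<open>m - 1\<close> together with \<open>path_step\<close> takes over.\<close>

lemma path_or_cycle:
  assumes "3 \<le> m" "m < n" "finite V" "2 * n + (m - 1) div 2 \<le> card V"
  shows "path_in (\<lambda>e. \<not> E e) V m \<or> cycle_in E V n"
  using assms
proof (induction m arbitrary: n V rule: less_induct)
  case (less m)
  note IHm = less.IH
  define k where "k = (m + 1) div 2"
  have k: "2 \<le> k" "m \<le> 2 * k" "2 * k \<le> m + 1" "(m - 1) div 2 = k - 1"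
    using less.prems(1) unfolding k_def by auto
  have \<open>3 \<le> m\<close> by (rule less.prems(1))
  from less.prems(2-4) show ?case
  proof (induction n rule: less_induct)
    case (less n)
    show ?case
    proof (rule disjCI)
      assume no: "\<not> cycle_in E V n"
      have step: "path_in (\<lambda>e. \<not> E e) V m" if "cycle_in E V (n - 1)" "2 * k \<le> n - 1"
      proof -
        have "path_in (\<lambda>e. \<not> E e) V (2 * k)"
        proof (rule cycle_step[OF less.prems(2) _ k(1) that(2,1)])
          show "2 * (n - 1) + k + 1 \<le> card V" using less.prems k by linarith
          show "\<not> cycle_in E V (n - 1 + 1)" using no less.prems(1) by simp
        qed
        then show ?thesis using k(2) by (rule path_in_mono)
      qed
      show "path_in (\<lambda>e. \<not> E e) V m"
      proof (cases "n = m + 1")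
        case False
        then have "path_in (\<lambda>e. \<not> E e) V m \<or> cycle_in E V (n - 1)"
          using less.prems by (intro less.IH) auto
        then show ?thesis using step False less.prems(1) k(3) by auto
      next
        case True
        show ?thesis
        proof (rule ccontr)
          assume nop: "\<not> path_in (\<lambda>e. \<not> E e) V m"
          \<comment> \<open>If a red path of length \<open>m - 1\<close> is longest,
            \<open>path_step\<close> yields a blue cycle of length \<open>2 * k\<close>. For odd
            \<open>m\<close> this is the forbidden length \<open>n\<close>. For even
            \<open>m\<close> it is \<open>n - 1\<close>, and \<open>cycle_step\<close> applies. In
            both cases the vertex count required by \<open>path_step\<close> is met with equality
            when \<open>card V\<close> is minimal.\<close>
          consider (odd) "m = 2 * k - 1" | (even) "m = 2 * k" using k by linarith
          then show False
          proof cases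
            case odd
            have "path_in (\<lambda>e. \<not> E e) V (m - 1)"
            proof (cases "m = 3")
              case m3: True
              then have "\<not> cycle_in E V 4" "8 \<le> card V" using no True less.prems(3) by auto
              then show ?thesis using path_two_or_cycle_four[of V E] m3 by auto
            next
              case False
              have "path_in (\<lambda>e. \<not> E e) V (m - 1) \<or> cycle_in E V n"
                by (rule IHm) (use False less.prems odd k True in auto)
              then show ?thesis using no by blast
            qed
            then have "cycle_in (\<lambda>e. \<not> \<not> E e) V (2 * k)"
            proof (rule path_step[OF less.prems(2) _ k(1), rotated 2])
              show "2 * (m - 1) + k + 3 \<le> card V" using less.prems odd k True by linarith
              show "2 * k - 2 \<le> m - 1" using odd by simp
              show "\<not> path_in (\<lambda>e. \<not> E e) V (m - 1 + 1)" using nop \<open>3 \<le> m\<close> by simp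
            qed
            then show False using no True odd k by simp
          next
            case even
            have "path_in (\<lambda>e. \<not> E e) V (m - 1) \<or> cycle_in E V (2 * k)"
              by (rule IHm) (use less.prems even k True in auto)
            then have "cycle_in E V (2 * k)"
            proof
              assume "path_in (\<lambda>e. \<not> E e) V (m - 1)"
              then have "cycle_in (\<lambda>e. \<not> \<not> E e) V (2 * k)"
              proof (rule path_step[OF less.prems(2) _ k(1), rotated 2])
                show "2 * (m - 1) + k + 3 \<le> card V" using less.prems even k True by linarith
                show "2 * k - 2 \<le> m - 1" using even by simp
                show "\<not> path_in (\<lambda>e. \<not> E e) V (m - 1 + 1)" using nop \<open>3 \<le> m\<close> by simp
              qed
              then show ?thesis by simp
            qed
            then show False using step nop True even by simp
          qed
        qed
      qed
    qed
  qed
qed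

section \<open>From vertex lists to copies, and the lower bound\<close>

lemma contains_loose_path:
  assumes "path_in (\<lambda>e. c e = k) {1..N} m"
  shows "contains_copy (colour_class (complete3 N) c k) (loose_path m)"
proof -
  obtain vs where vs: "lpath (\<lambda>e. c e = k) vs" "distinct vs" "length vs = 2 * m + 1" "set vs \<subseteq> {1..N}"
    using assms by (auto simp: path_in_def)
  let ?f = "\<lambda>j. vs ! (j - 1)"
  have "inj_on ?f {1..2 * m + 1}"
  proof (rule inj_onI)
    fix i j assume "i \<in> {1..2 * m + 1}" "j \<in> {1..2 * m + 1}" "?f i = ?f j"
    then have "i - 1 = j - 1" "1 \<le> i" "1 \<le> j" using vs(2,3) by (auto simp: nth_eq_iff_index_eq)
    then show "i = j" by simp
  qed
  moreover have "?f ` {1..2 * m + 1} \<subseteq> {1..N}"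
  proof -
    have "?f j \<in> {1..N}" if "j \<in> {1..2 * m + 1}" for j
      using that vs(3) by (intro subsetD[OF vs(4)] nth_mem) auto
    then show ?thesis by blast
  qed
  moreover have "?f ` {2 * i + 1, 2 * i + 2, 2 * i + 3} \<in> {e \<in> {e. e \<subseteq> {1..N} \<and> card e = 3}. c e = k}"
    if i: "i < m" for i
  proof -
    have f: "?f ` {2 * i + 1, 2 * i + 2, 2 * i + 3} = {vs ! (2 * i), vs ! (2 * i + 1), vs ! (2 * i + 2)}"
      by simp
    have "c {vs ! (2 * i), vs ! (2 * i + 1), vs ! (2 * i + 2)} = k"
      using vs(1,3) i unfolding lpath_nth by auto
    moreover have "card {vs ! (2 * i), vs ! (2 * i + 1), vs ! (2 * i + 2)} = 3"
      using vs(2,3) i by (simp add: card_insert_if nth_eq_iff_index_eq)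
    moreover have "{vs ! (2 * i), vs ! (2 * i + 1), vs ! (2 * i + 2)} \<subseteq> {1..N}"
      using vs(3) i by (intro subset_trans[OF _ vs(4)]) auto
    ultimately show ?thesis unfolding f by simp
  qed
  ultimately show ?thesis
    unfolding contains_copy_def loose_path_def colour_class_def complete3_def
    by (intro exI[of _ ?f]) auto
qed

lemma contains_loose_cycle:
  assumes "cycle_in (\<lambda>e. c e = k) {1..N} n" "2 \<le> n"
  shows "contains_copy (colour_class (complete3 N) c k) (loose_cycle n)"
proof -
  obtain vs where vs: "lpath (\<lambda>e. c e = k) vs" "hd vs = last vs" "distinct (tl vs)" "length vs = 2 * n + 1"
    "set vs \<subseteq> {1..N}"
    using assms(1) by (auto simp: cycle_in_def)
  let ?f = "\<lambda>j. vs ! (j - 1)"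
  have closed: "vs ! (2 * n) = vs ! 0" by (rule closed_nth[OF vs(2,4)])
  have inj: "x = y" if xy: "vs ! x = vs ! y" "x < 2 * n" "y < 2 * n" for x y
  proof -
    \<comment> \<open>Distinctness is known for positions \<open>1\<close> to \<open>2 * n\<close>;
      position \<open>0\<close> carries the same vertex as \<open>2 * n\<close> and is moved
      there.\<close>
    define s where "s z = (if z = 0 then 2 * n else z)" for z :: nat
    have "vs ! s z = vs ! z" for z using closed by (simp add: s_def)
    then have 1: "vs ! s x = vs ! s y" using xy(1) by simp
    have 2: "s x \<in> {1..2 * n}" "s y \<in> {1..2 * n}" using xy(2,3) by (auto simp: s_def)
    have "inj_on ((!) vs) {1..2 * n}"
      by (rule inj_on_nth_interval[OF vs(3)]) (use vs(4) in simp_all)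
    from inj_onD[OF this 1 2] have "s x = s y" .
    then show ?thesis using xy(2,3) by (simp add: s_def split: if_splits)
  qed
  have "inj_on ?f {1..2 * n}"
  proof (rule inj_onI)
    fix i j assume ij: "i \<in> {1..2 * n}" "j \<in> {1..2 * n}" "?f i = ?f j"
    have "i - 1 = j - 1" by (rule inj[OF ij(3)]) (use ij(1,2) in auto)
    then show "i = j" using ij by auto
  qed
  moreover have "?f ` {1..2 * n} \<subseteq> {1..N}"
  proof -
    have "?f j \<in> {1..N}" if "j \<in> {1..2 * n}" for j
      using that vs(4) by (intro subsetD[OF vs(5)] nth_mem) auto
    then show ?thesis by blast
  qed
  moreover have "?f ` {(2 * i) mod (2 * n) + 1, (2 * i + 1) mod (2 * n) + 1, (2 * i + 2) mod (2 * n) + 1}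
      \<in> {e \<in> {e. e \<subseteq> {1..N} \<and> card e = 3}. c e = k}"
    if i: "i < n" for i
  proof -
    have m: "(2 * i) mod (2 * n) = 2 * i" "(2 * i + 1) mod (2 * n) = 2 * i + 1" using i by simp_all
    have e: "vs ! ((2 * i + 2) mod (2 * n)) = vs ! (2 * i + 2)"
    proof (cases "i = n - 1")
      case True
      then have "2 * i + 2 = 2 * n" using i by simp
      then show ?thesis using closed by simp
    next
      case False
      then show ?thesis using i by simp
    qed
    have f: "?f ` {(2 * i) mod (2 * n) + 1, (2 * i + 1) mod (2 * n) + 1, (2 * i + 2) mod (2 * n) + 1}
        = {vs ! (2 * i), vs ! (2 * i + 1), vs ! (2 * i + 2)}"
      unfolding m using e by simp
    have "c {vs ! (2 * i), vs ! (2 * i + 1), vs ! (2 * i + 2)} = k"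
      using vs(1,4) i unfolding lpath_nth by auto
    moreover have "card {vs ! (2 * i), vs ! (2 * i + 1), vs ! (2 * i + 2)} = 3"
    proof -
      have ne: "(2 * i + 2) mod (2 * n) \<noteq> 2 * i \<and> (2 * i + 2) mod (2 * n) \<noteq> 2 * i + 1"
      proof (cases "i = n - 1")
        case True
        then have "2 * i + 2 = 2 * n" using i by simp
        then have "(2 * i + 2) mod (2 * n) = 0" by simp
        then show ?thesis using True assms(2) by simp
      next
        case False
        then show ?thesis using i by simp
      qed
      have lt: "(2 * i + 2) mod (2 * n) < 2 * n" using i by simp
      have "vs ! (2 * i) \<noteq> vs ! (2 * i + 1)" using inj[of "2 * i" "2 * i + 1"] i by auto
      moreover have "vs ! (2 * i) \<noteq> vs ! (2 * i + 2)"
        using inj[of "2 * i" "(2 * i + 2) mod (2 * n)"] ne lt i unfolding e by auto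
      moreover have "vs ! (2 * i + 1) \<noteq> vs ! (2 * i + 2)"
        using inj[of "2 * i + 1" "(2 * i + 2) mod (2 * n)"] ne lt i unfolding e by auto
      ultimately show ?thesis by simp
    qed
    moreover have "{vs ! (2 * i), vs ! (2 * i + 1), vs ! (2 * i + 2)} \<subseteq> {1..N}"
      using vs(4) i by (intro subset_trans[OF _ vs(5)]) auto
    ultimately show ?thesis unfolding f by simp
  qed
  ultimately show ?thesis
    unfolding contains_copy_def loose_cycle_def colour_class_def complete3_def
    by (intro exI[of _ ?f]) auto
qed

lemma not_arrows:
  assumes "3 \<le> m" "m < n" "N < 2 * n + (m - 1) div 2"
  shows "\<not> arrows N (loose_path m) (loose_cycle n)"
proof -
  define c where "c e = (if e \<subseteq> {1..2 * n - 1} then Blue else Red)" for e :: "nat set"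
  have "\<not> contains_copy (colour_class (complete3 N) c Red) (loose_path m)"
  proof
    assume "contains_copy (colour_class (complete3 N) c Red) (loose_path m)"
    then obtain f where inj: "inj_on f {1..2 * m + 1}" and rng: "f ` {1..2 * m + 1} \<subseteq> {1..N}"
      and red: "\<forall>i<m. c (f ` {2 * i + 1, 2 * i + 2, 2 * i + 3}) = Red"
      by (auto simp: contains_copy_def colour_class_def complete3_def loose_path_def)
    \<comment> \<open>Every second edge of the path is taken: these \<open>(m + 1) div 2\<close>
      edges are pairwise disjoint, and each, being red, has a vertex in \<open>{2 * n..N}\<close>, a
      set with at most \<open>(m - 1) div 2\<close> elements.\<close>
    have "\<exists>j. j \<in> {4 * l + 1, 4 * l + 2, 4 * l + 3} \<and> f j \<in> {2 * n..N}" if l: "l < (m + 1) div 2" for l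
    proof -
      have "2 * l < m" using l by auto
      then have "c (f ` {2 * (2 * l) + 1, 2 * (2 * l) + 2, 2 * (2 * l) + 3}) = Red" using red by blast
      then obtain j where j: "j \<in> {4 * l + 1, 4 * l + 2, 4 * l + 3}" "f j \<notin> {1..2 * n - 1}"
        by (auto simp: c_def split: if_splits)
      moreover have "f j \<in> {1..N}" using rng j(1) \<open>2 * l < m\<close> by (intro subsetD[OF rng] imageI) auto
      ultimately show ?thesis by (intro exI[of _ j]) auto
    qed
    then obtain j where j: "\<And>l. l < (m + 1) div 2 \<Longrightarrow> j l \<in> {4 * l + 1, 4 * l + 2, 4 * l + 3} \<and> f (j l) \<in> {2 * n..N}"
      by metis
    have "inj_on (\<lambda>l. f (j l)) {..<(m + 1) div 2}"
    proof (rule inj_onI)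
      fix a b assume ab: "a \<in> {..<(m + 1) div 2}" "b \<in> {..<(m + 1) div 2}" "f (j a) = f (j b)"
      have "j a \<in> {1..2 * m + 1}" "j b \<in> {1..2 * m + 1}" using j[of a] j[of b] ab by auto
      then have "j a = j b" using inj ab(3) by (auto dest: inj_onD)
      then show "a = b" using j[of a] j[of b] ab(1,2) by auto
    qed
    moreover have "(\<lambda>l. f (j l)) ` {..<(m + 1) div 2} \<subseteq> {2 * n..N}" using j by blast
    ultimately have "(m + 1) div 2 \<le> card {2 * n..N}"
      using card_inj_on_le[of "\<lambda>l. f (j l)" "{..<(m + 1) div 2}" "{2 * n..N}"] by simp
    then show False using assms by simp
  qed
  moreover have "\<not> contains_copy (colour_class (complete3 N) c Blue) (loose_cycle n)"
  proof
    assume "contains_copy (colour_class (complete3 N) c Blue) (loose_cycle n)"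
    then obtain f where inj: "inj_on f {1..2 * n}"
      and blue: "\<forall>i<n. c (f ` {(2 * i) mod (2 * n) + 1, (2 * i + 1) mod (2 * n) + 1, (2 * i + 2) mod (2 * n) + 1}) = Blue"
      by (auto simp: contains_copy_def colour_class_def complete3_def loose_cycle_def)
    have "f j \<in> {1..2 * n - 1}" if j: "j \<in> {1..2 * n}" for j
    proof -
      define i where "i = (j - 1) div 2"
      have i: "i < n" "j - 1 = 2 * i \<or> j - 1 = 2 * i + 1" using j by (auto simp: i_def)
      have "f ` {(2 * i) mod (2 * n) + 1, (2 * i + 1) mod (2 * n) + 1, (2 * i + 2) mod (2 * n) + 1} \<subseteq> {1..2 * n - 1}"
        using blue i(1) by (auto simp: c_def split: if_splits)
      moreover have "j = (2 * i) mod (2 * n) + 1 \<or> j = (2 * i + 1) mod (2 * n) + 1"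
        using i j by auto
      ultimately show ?thesis by blast
    qed
    then have "f ` {1..2 * n} \<subseteq> {1..2 * n - 1}" by blast
    from card_inj_on_le[OF inj this] show False using assms by simp
  qed
  ultimately show ?thesis unfolding arrows_def by blast
qed

theorem theorem5p3:
  fixes m n :: nat
  assumes "3 \<le> m" and "m < n"
  shows "ramsey_number (loose_path m) (loose_cycle n) = 2 * n + (m - 1) div 2"
  unfolding ramsey_number_def
proof (rule Least_equality)
  show "arrows (2 * n + (m - 1) div 2) (loose_path m) (loose_cycle n)"
    unfolding arrows_def
  proof
    fix c :: "nat set \<Rightarrow> colour"
    let ?N = "2 * n + (m - 1) div 2"
    have "path_in (\<lambda>e. \<not> c e = Blue) {1..?N} m \<or> cycle_in (\<lambda>e. c e = Blue) {1..?N} n"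
      by (rule path_or_cycle[OF assms]) auto
    moreover have "(\<lambda>e. \<not> c e = Blue) = (\<lambda>e. c e = Red)" by (auto intro: colour.exhaust)
    ultimately show "contains_copy (colour_class (complete3 ?N) c Red) (loose_path m) \<or>
        contains_copy (colour_class (complete3 ?N) c Blue) (loose_cycle n)"
      using contains_loose_path contains_loose_cycle assms by auto
  qed
  show "2 * n + (m - 1) div 2 \<le> N" if "arrows N (loose_path m) (loose_cycle n)" for N
    using not_arrows[OF assms, of N] that by linarith
qed

end
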